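(* Let $p$ be a prime and let $r,\beta_1,\dots,\beta_r,d_1,\dots,d_r,N,\alpha_1,\dots,\alpha_N\in\mathbb{Z}^+$. Put $A:=\bigoplus_{i=1}^N \mathbb{Z}/p^{\alpha_i}\mathbb{Z}$ and $B_j:=\mathbb{Z}/p^{\beta_j}\mathbb{Z}$ for $1\le j\le r$, and for each $1\le j\le r$ let $f_j:A\to B_j$ be a function with $0<\operatorname{fdeg}(f_j)\le d_j$. Assume the indices are ordered so that $\alpha_1\ge\alpha_2\ge\dots\ge\alpha_N$ and $d_1p^{\beta_1}\ge d_2p^{\beta_2}\ge\dots\ge d_rp^{\beta_r}$. Define $$\mathcal{B}:=\sum_{j=1}^r d_j\frac{p^{\beta_j}-1}{p-1},\qquad L:=\beta_1+\lfloor\log_p(d_1)\rfloor,\qquad \breve\alpha_i:=\min\{\alpha_i,L\}\ (1\le i\le N),$$ $$\alpha:=\alpha_1+\dots+\alpha_N,\qquad \breve\alpha:=\breve\alpha_1+\dots+\breve\alpha_N,\qquad \breve{\mathcal{A}}:=\sum_{i=1}^N\frac{p^{\breve\alpha_i}-1}{p-1}.$$ For $1\le j\le \alpha_1$ let $\alpha_j':=\#\{1\le i\le N\mid \alpha_i\ge j\}$ (so $\alpha_1'+\dots+\alpha_{\alpha_1}'=\alpha$), and define $D_1,\dots,D_\alpha$ by $$(D_1,D_2,\dots,D_\alpha):=(\underbrace{1,\dots,1}_{\alpha_1'\text{ times}},\underbrace{p,\dots,p}_{\alpha_2'\text{ times}},\dots,\underbrace{p^{\alpha_1-1},\dots,p^{\alpha_1-1}}_{\alpha_{\alpha_1}'\text{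 times}}).$$ Let $Z_A(f_1,\dots,f_r):=\{x\in A\mid f_1(x)=0,\dots,f_r(x)=0\}$. Then $$\operatorname{ord}_p\bigl(\#Z_A(f_1,\dots,f_r)\bigr)\ \ge\ \begin{cases}\Bigl\lceil\dfrac{\breve{\mathcal{A}}-\mathcal{B}}{d_1p^{\beta_1-1}}\Bigr\rceil+\alpha-\breve\alpha & \text{if }\breve{\mathcal{A}}>\mathcal{B},\\[2ex] \alpha-\max\{1\le t\le\alpha\mid D_1+\dots+D_t\le\mathcal{B}\} & \text{if }\breve{\mathcal{A}}\le\mathcal{B}.\end{cases}$$
   Context: $\operatorname{ord}_p$ denotes the $p$-adic valuation on $\mathbb{Z}$, with $\operatorname{ord}_p(0)=\infty$. Functional degree (Aichinger–Moosbauer): for commutative groups $A,B$ and $f:A\to B$, and $a\in A$, let $\Delta_a f:A\to B$ be $x\mapsto f(x+a)-f(x)$. Then $\operatorname{fdeg}(f):=-\infty$ if $f=0$; otherwise $\operatorname{fdeg}(f)$ is the least $d\in\mathbb{N}$ such that $\Delta_{a_1}\Delta_{a_2}\cdots\Delta_{a_{d+1}}f=0$ for all $a_1,\dots,a_{d+1}\in A$, and $\operatorname{fdeg}(f)=\infty$ if no such $d$ exists. *)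

theory Defs
  imports
    "HOL-Algebra.Product_Groups"
    "HOL-Computational_Algebra.Primes"
    "HOL-Library.Extended_Real"
begin

text \<open>
  Commutative groups are \<open>HOL-Algebra\<close> structures, which are written multiplicatively: the group
  operation plays the role of \<open>+\<close> and the neutral element that of \<open>0\<close>. Functions matter on the
  carrier only.
\<close>

definition fwd_diff ::
  "('a, 'm) monoid_scheme \<Rightarrow> ('b, 'n) monoid_scheme \<Rightarrow> 'a \<Rightarrow> ('a \<Rightarrow> 'b) \<Rightarrow> 'a \<Rightarrow> 'b" where
  "fwd_diff A B a f = (\<lambda>x. f (x \<otimes>\<^bsub>A\<^esub> a) \<otimes>\<^bsub>B\<^esub> inv\<^bsub>B\<^esub> (f x))"

definition zero_fun ::
  "('a, 'm) monoid_scheme \<Rightarrow> ('b, 'n) monoid_scheme \<Rightarrow> ('a \<Rightarrow> 'b) \<Rightarrow> bool" where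
  "zero_fun A B f \<longleftrightarrow> (\<forall>x\<in>carrier A. f x = \<one>\<^bsub>B\<^esub>)"

text \<open>For \<open>as = [a\<^sub>1, \<dots>, a\<^sub>k]\<close>, \<open>foldr (fwd_diff A B) as f\<close> is
  \<open>\<Delta> a\<^sub>1 (\<Delta> a\<^sub>2 (\<dots> (\<Delta> a\<^sub>k f)))\<close>.\<close>

definition diffs_vanish ::
  "('a, 'm) monoid_scheme \<Rightarrow> ('b, 'n) monoid_scheme \<Rightarrow> ('a \<Rightarrow> 'b) \<Rightarrow> nat \<Rightarrow> bool" where
  "diffs_vanish A B f k \<longleftrightarrow>
     (\<forall>as. length as = k \<and> set as \<subseteq> carrier A \<longrightarrow> zero_fun A B (foldr (fwd_diff A B) as f))"

definition fdeg ::
  "('a, 'm) monoid_scheme \<Rightarrow> ('b, 'n) monoid_scheme \<Rightarrow> ('a \<Rightarrow> 'b) \<Rightarrow> ereal" where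
  "fdeg A B f =
     (if zero_fun A B f then - \<infinity>
      else if \<exists>d. diffs_vanish A B f (d + 1)
           then ereal (real (LEAST d. diffs_vanish A B f (d + 1)))
      else \<infinity>)"

text \<open>\<^const>\<open>multiplicity\<close> is \<open>0\<close> at \<open>0\<close>, whereas the valuation of \<open>0\<close> is \<open>\<infinity>\<close>.\<close>

definition padic_ord :: "nat \<Rightarrow> int \<Rightarrow> ereal" where
  "padic_ord p n = (if n = 0 then \<infinity> else ereal (real (multiplicity (int p) n)))"

definition common_zeros ::
  "('a, 'm) monoid_scheme \<Rightarrow> (nat \<Rightarrow> ('b, 'n) monoid_scheme) \<Rightarrow> nat \<Rightarrow> (nat \<Rightarrow> 'a \<Rightarrow> 'b) \<Rightarrow> 'a set" where
  "common_zeros A B r f = {x \<in> carrier A. \<forall>j\<in>{1..r}. f j x = \<one>\<^bsub>B j\<^esub>}"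

definition conj_part :: "nat \<Rightarrow> (nat \<Rightarrow> nat) \<Rightarrow> nat \<Rightarrow> nat" where
  "conj_part N \<alpha> j = card {i \<in> {1..N}. \<alpha> i \<ge> j}"

text \<open>The sequence \<open>D\<^sub>1, \<dots>, D\<^sub>\<alpha>\<close> as a list, so that \<open>D\<^sub>s\<close> is the list entry with index \<open>s - 1\<close>.
  The definition presupposes that \<open>\<alpha> 1\<close> is the largest of \<open>\<alpha> 1, \<dots>, \<alpha> N\<close>.\<close>

definition D_list :: "nat \<Rightarrow> nat \<Rightarrow> (nat \<Rightarrow> nat) \<Rightarrow> nat list" where
  "D_list p N \<alpha> = concat (map (\<lambda>j. replicate (conj_part N \<alpha> j) (p ^ (j - 1))) [1..<\<alpha> 1 + 1])"

end

theory Submission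
  imports Defs "HOL-Computational_Algebra.Polynomial" "HOL-Library.Multiset"
begin

text \<open>
  Pull the \<open>f\<^sub>j\<close> back to \<open>\<nat>\<^sup>N\<close>. By Newton expansion a function of functional degree at most \<open>d\<close>
  into \<open>\<int>/q\<close> lifts to a function \<open>F\<close> with values in \<open>\<nat>\<close> all of whose \<open>(d+1)\<close>-fold differences
  vanish over \<open>\<int>\<close>. The indicator of the multiples of \<open>p\<^sup>b\<close> expands as \<open>\<Sum>k. a\<^sub>k (F choose k)\<close>, where
  \<open>p\<^sup>s\<close> divides \<open>a\<^sub>k\<close> for some \<open>s\<close> with \<open>k \<le> p\<^sup>b - 1 + s (p\<^sup>b - p\<^sup>b\<^sup>-\<^sup>1)\<close>. Multiplying these
  expansions writes the number of zeros as a combination of sums of functions of bounded degree \<open>n\<close>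
  over the box \<open>\<Prod>i. [0, p\<^bsup>\<alpha> i\<^esup>)\<close>. Since \<open>\<Sum>y<p\<^sup>a. (y choose m) = (p\<^sup>a choose m + 1)\<close>, such a sum is
  divisible by \<open>p\<close> to the power \<open>\<Sum>i. \<alpha> i - e i\<close>, minimised over \<open>e \<le> \<alpha>\<close> with
  \<open>\<Sum>i. (p\<^bsup>e i\<^esup> - 1) \<le> n\<close>. The bound is the value of the resulting optimisation problem.
\<close>

subsection \<open>Differences of periodic sequences\<close>

definition fdiff :: "(nat \<Rightarrow> int) \<Rightarrow> nat \<Rightarrow> int" where
  "fdiff g n = g (Suc n) - g n"

text \<open>A shift by one is the identity plus \<open>fdiff\<close>. The induction on
  \<open>n\<close> therefore moves the base point to \<open>Suc m\<close>, and Pascal's rule merges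
  the two resulting sums.\<close>

lemma newton_expansion: "g (m + n) = (\<Sum>k\<le>n. int (n choose k) * (fdiff ^^ k) g m)"
proof (induction n arbitrary: m)
  case (Suc n)
  have "g (m + Suc n) = g (Suc m + n)" by simp
  also have "\<dots> = (\<Sum>k\<le>n. int (n choose k) * (fdiff ^^ k) g (Suc m))" by (rule Suc)
  also have "\<dots> = (\<Sum>k\<le>n. int (n choose k) * ((fdiff ^^ k) g m + (fdiff ^^ Suc k) g m))"
    by (simp add: fdiff_def)
  also have "\<dots> = (\<Sum>k\<le>n. int (n choose k) * (fdiff ^^ k) g m) +
      (\<Sum>k\<le>n. int (n choose k) * (fdiff ^^ Suc k) g m)"
    by (simp only: distrib_left sum.distrib)
  also have "(\<Sum>k\<le>n. int (n choose k) * (fdiff ^^ k) g m) =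
      g m + (\<Sum>k\<le>n. int (n choose Suc k) * (fdiff ^^ Suc k) g m)"
  proof -
    have "(\<Sum>k\<le>n. int (n choose k) * (fdiff ^^ k) g m) =
      (\<Sum>k\<le>Suc n. int (n choose k) * (fdiff ^^ k) g m)" by simp
    then show ?thesis by (simp only: sum.atMost_Suc_shift) simp
  qed
  also have "g m + (\<Sum>k\<le>n. int (n choose Suc k) * (fdiff ^^ Suc k) g m) +
      (\<Sum>k\<le>n. int (n choose k) * (fdiff ^^ Suc k) g m) =
      g m + (\<Sum>k\<le>n. int (Suc n choose Suc k) * (fdiff ^^ Suc k) g m)"
    by (simp only: add.assoc sum.distrib[symmetric] binomial_Suc_Suc of_nat_add distrib_right)
       (simp add: add.commute)
  also have "\<dots> = (\<Sum>k\<le>Suc n. int (Suc n choose k) * (fdiff ^^ k) g m)"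
    by (simp only: sum.atMost_Suc_shift) simp
  finally show ?case .
qed simp

text \<open>The polynomial \<open>X\<close> acts on sequences as the shift.\<close>

definition shift_act :: "int poly \<Rightarrow> (nat \<Rightarrow> int) \<Rightarrow> nat \<Rightarrow> int" where
  "shift_act P g = fold_coeffs (\<lambda>a h n. a * g n + h (Suc n)) P (\<lambda>_. 0)"

lemma shift_act_0 [simp]: "shift_act 0 g = (\<lambda>_. 0)"
  by (simp add: shift_act_def)

lemma shift_act_pCons [simp]:
  "shift_act (pCons a P) g = (\<lambda>n. a * g n + shift_act P g (Suc n))"
  by (cases "a = 0 \<and> P = 0") (auto simp: shift_act_def)

lemma shift_act_zero_fun [simp]: "shift_act P (\<lambda>_. 0) = (\<lambda>_. 0)"
  by (induction P) auto

lemma shift_act_add: "shift_act (P + Q) g n = shift_act P g n + shift_act Q g n"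
  by (induction P Q arbitrary: n rule: poly_induct2) (simp_all add: algebra_simps)

lemma shift_act_smult: "shift_act (smult c P) g n = c * shift_act P g n"
  by (induction P arbitrary: n) (simp_all add: algebra_simps)

lemma shift_act_mult: "shift_act (P * Q) g n = shift_act P (shift_act Q g) n"
  by (induction P arbitrary: n) (simp_all add: shift_act_add shift_act_smult)

lemma shift_act_X_minus_1_power: "shift_act ([:-1, 1:] ^ k) g = (fdiff ^^ k) g"
proof (induction k)
  case (Suc k)
  then show ?case
    by (intro ext) (simp add: shift_act_mult fdiff_def del: mult_pCons_left)
qed (simp add: one_pCons)

lemma shift_act_monom: "shift_act (monom 1 k) g n = g (n + k)"
  by (induction k arbitrary: n) (simp_all add: monom_Suc monom_0)

section \<open>Powers of X - 1 modulo p and modulo X^(p^b) - 1\<close>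

text \<open>The coefficients \<open>p choose k\<close> with \<open>0 < k < p\<close> are multiples
  of \<open>p\<close>. The ring is general because the result is applied in
  \<open>int poly\<close>.\<close>

lemma prime_dvd_add_power_diff:
  fixes a b :: "'a::comm_ring_1"
  assumes "prime p"
  shows "of_nat p dvd (a + b) ^ p - (a ^ p + b ^ p)"
proof -
  have p: "p > 0" using assms prime_gt_0_nat by blast
  have "(a + b) ^ p = (\<Sum>k\<le>p. of_nat (p choose k) * a ^ k * b ^ (p - k))"
    by (rule binomial_ring)
  also have "{..p} = insert 0 (insert p {0<..<p})" using p by auto
  also have "(\<Sum>k\<in>\<dots>. of_nat (p choose k) * a ^ k * b ^ (p - k)) =
      b ^ p + a ^ p + (\<Sum>k\<in>{0<..<p}. of_nat (p choose k) * a ^ k * b ^ (p - k))"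
    using p by (simp add: add.assoc)
  finally have *: "(a + b) ^ p - (a ^ p + b ^ p) =
      (\<Sum>k\<in>{0<..<p}. of_nat (p choose k) * a ^ k * b ^ (p - k))" by simp
  show ?thesis unfolding *
  proof (rule dvd_sum)
    fix k assume "k \<in> {0<..<p}"
    then have "p dvd p choose k" using assms by (intro dvd_choose_prime) auto
    then obtain c where "p choose k = p * c" by (elim dvdE)
    then show "of_nat p dvd of_nat (p choose k) * a ^ k * b ^ (p - k)"
      by (simp add: mult.assoc)
  qed
qed

lemma dvd_diff_power:
  fixes a b :: "'a::comm_ring_1"
  assumes "c dvd a - b"
  shows "c dvd a ^ n - b ^ n"
  using assms by (metis dvd_mult2 power_diff_sumr2)

text \<open>Frobenius modulo \<open>p\<close>, iterated: the congruence for \<open>b\<close> is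
  raised to the \<open>p\<close>-th power, and \<open>prime_dvd_add_power_diff\<close> splits the
  power of \<open>?T + (- 1)\<close>.\<close>

lemma prime_dvd_X_minus_1_power:
  assumes "prime p"
  shows "of_nat p dvd ([:-1, 1:] :: int poly) ^ (p ^ b) - (monom 1 (p ^ b) - 1)"
proof (induction b)
  case 0
  show ?case by (simp add: monom_Suc monom_0 one_pCons)
next
  case (Suc b)
  let ?T = "monom 1 (p ^ b) :: int poly"
  \<comment> \<open>For odd \<open>p\<close> the sign is right; for \<open>p = 2\<close> the
    discrepancy is 2, itself a multiple of \<open>p\<close>.\<close>
  have m1: "(of_nat p :: int poly) dvd (-1) ^ p - (-1)"
  proof (cases "p = 2")
    case False
    then have "odd p" using assms prime_odd_nat[of p] prime_ge_2_nat[of p] by auto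
    then show ?thesis by simp
  qed simp
  have "of_nat p dvd ([:-1, 1:] ^ (p ^ b)) ^ p - (?T - 1) ^ p"
    using Suc by (rule dvd_diff_power)
  moreover have "of_nat p dvd (?T + (- 1)) ^ p - (?T ^ p + (- 1) ^ p)"
    using assms by (rule prime_dvd_add_power_diff)
  ultimately have "of_nat p dvd
     (([:-1, 1:] ^ (p ^ b)) ^ p - (?T - 1) ^ p) + ((?T + (- 1)) ^ p - (?T ^ p + (- 1) ^ p)) +
     ((-1) ^ p - (-1))"
    using m1 by (intro dvd_add)
  then show ?case
    by (simp add: power_mult[symmetric] monom_power mult.commute algebra_simps)
qed

text \<open>With \<open>T = X ^ (p ^ b)\<close> the left power is \<open>(T - 1) ^ (p - 1)\<close>
  modulo \<open>p\<close>, and all coefficients of the latter in powers of \<open>T\<close> are 1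
  modulo \<open>p\<close>.\<close>

lemma prime_dvd_X_minus_1_power_geometric:
  assumes "prime p"
  shows "of_nat p dvd ([:-1, 1:] :: int poly) ^ (p ^ b * (p - 1)) - (\<Sum>i<p. monom 1 (p ^ b * i))"
proof -
  let ?T = "monom 1 (p ^ b) :: int poly" and ?Y = "([:-1, 1:] :: int poly) ^ (p ^ b)"
  have p0: "p > 0" using assms prime_gt_0_nat by blast
  have "of_nat p dvd ?Y ^ (p - 1) - (?T - 1) ^ (p - 1)"
    using prime_dvd_X_minus_1_power[OF assms] by (rule dvd_diff_power)
  moreover have "of_nat p dvd (?T - 1) ^ (p - 1) - (\<Sum>i<p. ?T ^ i)"
  proof -
    \<comment> \<open>Descending induction from \<open>i = p - 1\<close>, where the value is 1: two
      neighbouring binomials add up to \<open>p choose Suc i\<close>, a multiple of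
      \<open>p\<close>, so the alternating sign keeps the residue at 1.\<close>
    have step: "(of_int (int p) :: int) dvd (-1) ^ (p - 1 - i) * int (p - 1 choose i) - 1" if "i \<le> p - 1" for i
      using that
    proof (induction "p - 1 - i" arbitrary: i)
      case 0
      then have "i = p - 1" by simp
      then show ?case by simp
    next
      case (Suc m)
      have i: "Suc i \<le> p - 1" "m = p - 1 - Suc i" using Suc.hyps(2) by auto
      have "p dvd p choose Suc i" using assms i p0 by (intro dvd_choose_prime) auto
      moreover have "p choose Suc i = (p - 1 choose i) + (p - 1 choose Suc i)"
        using binomial_Suc_Suc[of "p - 1" i] p0 by simp
      ultimately have "int p dvd int (p - 1 choose i) + int (p - 1 choose Suc i)"
        by (metis of_nat_add of_nat_dvd_iff)
      then have a: "int p dvd (-1) ^ Suc m * (int (p - 1 choose i) + int (p - 1 choose Suc i))"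
        by (rule dvd_mult)
      have b: "int p dvd (-1) ^ m * int (p - 1 choose Suc i) - 1"
        using Suc.hyps(1)[OF i(2) i(1)] i by simp
      have "(-1) ^ Suc m * int (p - 1 choose i) - 1 =
          (-1) ^ Suc m * (int (p - 1 choose i) + int (p - 1 choose Suc i)) +
          ((-1) ^ m * int (p - 1 choose Suc i) - 1)"
        by (simp add: algebra_simps)
      then have "int p dvd (-1) ^ Suc m * int (p - 1 choose i) - 1"
        using dvd_add[OF a b] by (simp only:)
      then show ?case using Suc.hyps(2) by simp
    qed
    have "(?T + (-1)) ^ (p - 1) = (\<Sum>i\<le>p-1. of_nat (p - 1 choose i) * ?T ^ i * (-1) ^ (p - 1 - i))"
      by (rule binomial_ring)
    also have "{..p-1} = {..<p}" using p0 by auto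
    finally have "(?T - 1) ^ (p - 1) - (\<Sum>i<p. ?T ^ i) =
      (\<Sum>i<p. of_int ((-1) ^ (p - 1 - i) * int (p - 1 choose i) - 1) * ?T ^ i)"
      by (simp add: sum_subtractf[symmetric] algebra_simps)
    also have "of_nat p dvd \<dots>"
    proof (rule dvd_sum)
      fix i assume "i \<in> {..<p}"
      then have "int p dvd (-1) ^ (p - 1 - i) * int (p - 1 choose i) - 1" using step[of i] by auto
      then obtain c where "(-1) ^ (p - 1 - i) * int (p - 1 choose i) - 1 = int p * c" by (elim dvdE)
      then show "of_nat p dvd of_int ((-1) ^ (p - 1 - i) * int (p - 1 choose i) - 1) * ?T ^ i"
        by (metis dvd_triv_left mult.assoc of_int_mult of_int_of_nat_eq)
    qed
    finally show ?thesis .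
  qed
  ultimately have "of_nat p dvd (?Y ^ (p - 1) - (?T - 1) ^ (p - 1)) + ((?T - 1) ^ (p - 1) - (\<Sum>i<p. ?T ^ i))"
    by (rule dvd_add)
  then show ?thesis by (simp add: power_mult[symmetric] monom_power)
qed

text \<open>Used modulo \<open>M = T\<^sup>p - 1\<close> for \<open>T = X\<close> to the power \<open>p\<^sup>b\<^sup>-\<^sup>1\<close>, \<open>\<Phi> = 1 + T + \<dots> + T\<^sup>p\<^sup>-\<^sup>1\<close>
  and \<open>W = T - 1\<close>.\<close>

lemma geometric_ideal_power:
  fixes \<Phi> W g h c :: "'a::comm_ring_1"
  assumes "M dvd \<Phi> * W" "M dvd \<Phi> * \<Phi> - c * \<Phi>"
  shows "\<exists>u. M dvd (\<Phi> + c * g) ^ Suc s * (W + c * h) - c ^ Suc s * u"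
proof -
  \<comment> \<open>Modulo \<open>M\<close> a product of two copies of \<open>\<Phi>\<close> trades
    one of them for a factor \<open>c\<close>. Hence every term of the expanded power except the
    pure one is a multiple of \<open>c ^ s * \<Phi>\<close>, and \<open>W\<close> then kills
    \<open>\<Phi>\<close>.\<close>
  have "\<exists>u. M dvd (\<Phi> + c * g) ^ Suc s - (c ^ Suc s * g ^ Suc s + c ^ s * \<Phi> * u)"
  proof (induction s)
    case 0 show ?case by (rule exI[of _ 1]) simp
  next
    case (Suc s)
    then obtain u where u: "M dvd (\<Phi> + c * g) ^ Suc s - (c ^ Suc s * g ^ Suc s + c ^ s * \<Phi> * u)" by blast
    let ?u = "g ^ Suc s + u + g * u"
    have "(\<Phi> + c * g) ^ Suc (Suc s) - (c ^ Suc (Suc s) * g ^ Suc (Suc s) + c ^ Suc s * \<Phi> * ?u) =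
      (\<Phi> + c * g) * ((\<Phi> + c * g) ^ Suc s - (c ^ Suc s * g ^ Suc s + c ^ s * \<Phi> * u)) +
      (c ^ s * u) * (\<Phi> * \<Phi> - c * \<Phi>)"
      by (simp add: algebra_simps)
    moreover have "M dvd \<dots>"
      using u assms(2) by (intro dvd_add dvd_mult)
    ultimately show ?case by metis
  qed
  then obtain u where u: "M dvd (\<Phi> + c * g) ^ Suc s - (c ^ Suc s * g ^ Suc s + c ^ s * \<Phi> * u)" by blast
  let ?v = "g ^ Suc s * (W + c * h) + \<Phi> * u * h"
  have "(\<Phi> + c * g) ^ Suc s * (W + c * h) - c ^ Suc s * ?v =
    (W + c * h) * ((\<Phi> + c * g) ^ Suc s - (c ^ Suc s * g ^ Suc s + c ^ s * \<Phi> * u)) + (c ^ s * u) * (\<Phi> * W)"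
    by (simp add: algebra_simps)
  moreover have "M dvd \<dots>"
    by (rule dvd_add[OF dvd_mult[OF u] dvd_mult[OF assms(1)]])
  ultimately show ?thesis by metis
qed

text \<open>With \<open>Q = p ^ (b - 1)\<close> the least exponent allowed is
  \<open>Suc s * (p ^ b - Q) + Q\<close>. Modulo \<open>p\<close>, the power with exponent
  \<open>p ^ b - Q\<close> is \<open>\<Phi>\<close> and the one with exponent \<open>Q\<close> is
  \<open>T - 1\<close>, which is the shape that \<open>geometric_ideal_power\<close> treats, with
  \<open>c = p\<close>.\<close>

lemma X_minus_1_power_mod:
  assumes "prime p" "b \<ge> 1" "k \<ge> p ^ b + s * (p ^ b - p ^ (b - 1))"
  shows "\<exists>u. (monom 1 (p ^ b) - 1 :: int poly) dvd [:-1, 1:] ^ k - of_nat (p ^ Suc s) * u"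
proof -
  let ?Q = "p ^ (b - 1)" and ?X = "[:-1, 1:] :: int poly"
  let ?T = "monom 1 ?Q :: int poly"
  let ?\<Phi> = "\<Sum>i<p. ?T ^ i"
  let ?M = "monom 1 (p ^ b) - 1 :: int poly"
  have p0: "p > 0" using assms(1) prime_gt_0_nat by blast
  have pb: "p ^ b = p * ?Q" using assms(2) by (cases b) auto
  have phi: "p ^ b - ?Q = ?Q * (p - 1)" by (simp add: pb algebra_simps)
  have M: "?M = ?T ^ p - 1" by (simp add: monom_power pb mult.commute)
  have W: "?\<Phi> * (?T - 1) = ?M"
    unfolding M using power_diff_1_eq[of ?T p] by (simp add: mult.commute)
  obtain h where h: "?X ^ ?Q = (?T - 1) + of_nat p * h"
    using prime_dvd_X_minus_1_power[OF assms(1), of "b - 1"] by (metis add_diff_cancel_left' diff_add_cancel add.commute dvdE)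
  have "of_nat p dvd ?X ^ (p ^ b - ?Q) - ?\<Phi>"
    using prime_dvd_X_minus_1_power_geometric[OF assms(1), of "b - 1"]
    unfolding phi by (simp add: monom_power mult.commute)
  then obtain g where g: "?X ^ (p ^ b - ?Q) = ?\<Phi> + of_nat p * g"
    by (metis add_diff_cancel_left' diff_add_cancel add.commute dvdE)
  \<comment> \<open>\<open>T\<close> acts as 1 on \<open>\<Phi>\<close> modulo \<open>?M\<close>;
    summing over the \<open>p\<close> powers of \<open>T\<close> turns
    \<open>\<Phi> * \<Phi>\<close> into \<open>p * \<Phi>\<close>.\<close>
  have "?M dvd ?T ^ i * ?\<Phi> - ?\<Phi>" for i
  proof -
    have "?T ^ i * ?\<Phi> - ?\<Phi> = (?T ^ i - 1) * ?\<Phi>" by (simp add: algebra_simps)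
    also have "\<dots> = ((?T - 1) * (\<Sum>j<i. ?T ^ j)) * ?\<Phi>" by (simp only: power_diff_1_eq)
    also have "\<dots> = ?M * (\<Sum>j<i. ?T ^ j)" by (simp only: W[symmetric] ac_simps)
    finally show ?thesis by simp
  qed
  then have "?M dvd (\<Sum>i<p. ?T ^ i * ?\<Phi> - ?\<Phi>)" by (intro dvd_sum)
  then have "?M dvd ?\<Phi> * ?\<Phi> - of_nat p * ?\<Phi>"
    by (simp add: sum_subtractf sum_distrib_right)
  then obtain u where u: "?M dvd (?\<Phi> + of_nat p * g) ^ Suc s * ((?T - 1) + of_nat p * h) - of_nat p ^ Suc s * u"
    using geometric_ideal_power[of ?M ?\<Phi> "?T - 1" "of_nat p" g s h] W by auto
  let ?k = "p ^ b + s * (p ^ b - ?Q)"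
  have "?Q \<le> p ^ b" using p0 by (intro power_increasing) auto
  then have "?k = Suc s * (p ^ b - ?Q) + ?Q" by simp
  then have "?X ^ ?k = (?X ^ (p ^ b - ?Q)) ^ Suc s * ?X ^ ?Q"
    by (simp only: power_add power_mult[symmetric] mult.commute)
  then have "?M dvd ?X ^ ?k - of_nat p ^ Suc s * u" using u g h by simp
  then have "?M dvd ?X ^ (k - ?k) * (?X ^ ?k - of_nat p ^ Suc s * u)" by (rule dvd_mult)
  then have "?M dvd ?X ^ k - of_nat (p ^ Suc s) * (?X ^ (k - ?k) * u)"
    using assms(3) by (simp add: algebra_simps power_add[symmetric])
  then show ?thesis by blast
qed

text \<open>A sequence of period \<open>p ^ b\<close> is annihilated by
  \<open>X ^ (p ^ b) - 1\<close>, so only the residue of \<open>(X - 1) ^ k\<close> modulo this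
  polynomial acts on it.\<close>

lemma fdiff_power_periodic_dvd:
  assumes "prime p" "b \<ge> 1" and per: "\<And>n. g (n + p ^ b) = g n"
  shows "\<exists>s. int p ^ s dvd (fdiff ^^ k) g n \<and> k \<le> p ^ b - 1 + s * (p ^ b - p ^ (b - 1))"
proof (cases "k < p ^ b")
  case True
  then show ?thesis by (intro exI[of _ 0]) auto
next
  case False
  let ?\<phi> = "p ^ b - p ^ (b - 1)"
  have p2: "p \<ge> 2" using assms(1) prime_ge_2_nat by blast
  have "p ^ (b - 1) < p ^ b" using p2 assms(2) by (intro power_strict_increasing) auto
  then have \<phi>: "?\<phi> > 0" by simp
  \<comment> \<open>The largest \<open>s\<close> with \<open>p ^ b + s * ?\<phi> \<le> k\<close>.
    The exponent obtained is \<open>Suc s\<close>, and maximality gives the upper bound on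
    \<open>k\<close>.\<close>
  define s where "s = (k - p ^ b) div ?\<phi>"
  have d: "s * ?\<phi> + (k - p ^ b) mod ?\<phi> = k - p ^ b" unfolding s_def by (rule div_mult_mod_eq)
  have m: "(k - p ^ b) mod ?\<phi> < ?\<phi>" using \<phi> by simp
  have "k \<ge> p ^ b + s * ?\<phi>" using d False by linarith
  then obtain u v where "[:-1, 1:] ^ k - of_nat (p ^ Suc s) * u = (monom 1 (p ^ b) - 1 :: int poly) * v"
    using X_minus_1_power_mod[OF assms(1,2)] by (metis dvdE)
  then have e: "[:-1, 1:] ^ k = smult (int p ^ Suc s) u + v * (monom 1 (p ^ b) + [:-1:])"
    by (simp add: algebra_simps of_nat_poly one_pCons flip: of_nat_power)
  have z: "shift_act (monom 1 (p ^ b) + [:-1:]) g = (\<lambda>_. 0)"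
    by (rule ext) (simp add: shift_act_add shift_act_monom per)
  have "(fdiff ^^ k) g n = shift_act ([:-1, 1:] ^ k) g n" by (simp add: shift_act_X_minus_1_power)
  also have "\<dots> = int p ^ Suc s * shift_act u g n"
    by (simp only: e shift_act_add shift_act_smult shift_act_mult z shift_act_zero_fun add_0_right)
  finally have "int p ^ Suc s dvd (fdiff ^^ k) g n" by simp
  moreover have "Suc s * ?\<phi> = s * ?\<phi> + ?\<phi>" by simp
  then have "k \<le> p ^ b - 1 + Suc s * ?\<phi>" using d m False p2 by linarith
  ultimately show ?thesis by blast
qed

subsection \<open>Integer-valued functions of bounded degree\<close>

definition pdiff :: "'i \<Rightarrow> (('i \<Rightarrow> nat) \<Rightarrow> int) \<Rightarrow> ('i \<Rightarrow> nat) \<Rightarrow> int" where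
  "pdiff i g x = g (x(i := Suc (x i))) - g x"

text \<open>Degree below \<open>n\<close> modulo \<open>q\<close> in the coordinates from \<open>S\<close>; the other coordinates are parameters.
  For \<open>q = 0\<close> the differences have to vanish.\<close>

primrec deg_lt :: "'i set \<Rightarrow> int \<Rightarrow> nat \<Rightarrow> (('i \<Rightarrow> nat) \<Rightarrow> int) \<Rightarrow> bool" where
  "deg_lt S q 0 g \<longleftrightarrow> (\<forall>x. q dvd g x)"
| "deg_lt S q (Suc n) g \<longleftrightarrow> (\<forall>i\<in>S. deg_lt S q n (pdiff i g))"

lemma deg_lt_0_imp: "deg_lt S q 0 g \<Longrightarrow> deg_lt S q n g"
  by (induction n arbitrary: g) (auto simp: pdiff_def)

lemma deg_lt_Suc: "deg_lt S q n g \<Longrightarrow> deg_lt S q (Suc n) g"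
proof (induction n arbitrary: g)
  case 0
  then show ?case by (rule deg_lt_0_imp)
qed simp

lemma deg_lt_mono: "deg_lt S q m g \<Longrightarrow> m \<le> n \<Longrightarrow> deg_lt S q n g"
  by (induction n) (auto simp del: deg_lt.simps simp: le_Suc_eq intro: deg_lt_Suc)

lemma deg_lt_add:
  "deg_lt S q n g \<Longrightarrow> deg_lt S q n h \<Longrightarrow> deg_lt S q n (\<lambda>x. g x + h x)"
proof (induction n arbitrary: g h)
  case (Suc n)
  have "pdiff i (\<lambda>x. g x + h x) = (\<lambda>x. pdiff i g x + pdiff i h x)" for i
    by (rule ext) (simp add: pdiff_def)
  then show ?case using Suc by simp
qed simp

lemma deg_lt_sum:
  "(\<And>k. k \<in> K \<Longrightarrow> deg_lt S q n (g k)) \<Longrightarrow> deg_lt S q n (\<lambda>x. \<Sum>k\<in>K. g k x)"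
  by (induction K rule: infinite_finite_induct)
     (auto simp del: deg_lt.simps intro: deg_lt_add deg_lt_0_imp[of S q "\<lambda>_. 0"] simp: deg_lt.simps(1))

lemma deg_lt_const: "deg_lt S q (Suc n) (\<lambda>x. c)"
  by (rule deg_lt_mono[of S q "Suc 0"]) (simp_all add: pdiff_def)

text \<open>Product rule for differences, with the additional term
  \<open>pdiff i g x * pdiff i h x\<close>. The bounds are strict, hence the \<open>- 1\<close>; if
  one of them is 0, the product is a multiple of \<open>q\<close>.\<close>

lemma deg_lt_mult:
  "deg_lt S q m g \<Longrightarrow> deg_lt S q n h \<Longrightarrow> deg_lt S q (m + n - 1) (\<lambda>x. g x * h x)"
proof (induction "m + n" arbitrary: m n g h rule: less_induct)
  case less
  show ?case
  proof (cases "m = 0 \<or> n = 0")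
    case True
    then have "\<forall>x. q dvd g x * h x" using less.prems by auto
    then show ?thesis by (simp add: deg_lt_0_imp)
  next
    case False
    then obtain m' n' where mn: "m = Suc m'" "n = Suc n'" by (metis not0_implies_Suc)
    have "deg_lt S q (m' + n') (pdiff i (\<lambda>x. g x * h x))" if "i \<in> S" for i
    proof -
      have g: "deg_lt S q m' (pdiff i g)" and h: "deg_lt S q n' (pdiff i h)"
        using less.prems that mn by auto
      have "pdiff i (\<lambda>x. g x * h x) =
        (\<lambda>x. pdiff i g x * h x + (g x * pdiff i h x + pdiff i g x * pdiff i h x))"
        by (rule ext) (simp add: pdiff_def algebra_simps)
      moreover have "deg_lt S q (m' + n - 1) (\<lambda>x. pdiff i g x * h x)"
        by (rule less.hyps) (use mn g less.prems in auto)
      moreover have "deg_lt S q (m + n' - 1) (\<lambda>x. g x * pdiff i h x)"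
        by (rule less.hyps) (use mn h less.prems in auto)
      moreover have "deg_lt S q (m' + n' - 1) (\<lambda>x. pdiff i g x * pdiff i h x)"
        by (rule less.hyps) (use mn g h in auto)
      then have "deg_lt S q (m' + n') (\<lambda>x. pdiff i g x * pdiff i h x)"
        by (rule deg_lt_mono) simp
      ultimately show ?thesis using mn by (auto intro!: deg_lt_add)
    qed
    then show ?thesis using mn by simp
  qed
qed

lemma deg_lt_prod:
  assumes "finite K" "\<And>k. k \<in> K \<Longrightarrow> deg_lt S q (Suc (d k)) (g k)"
  shows "deg_lt S q (Suc (\<Sum>k\<in>K. d k)) (\<lambda>x. \<Prod>k\<in>K. g k x)"
  using assms
proof (induction K rule: finite_induct)
  case empty
  show ?case using deg_lt_const by (simp del: deg_lt.simps)
next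
  case (insert k K)
  then have "deg_lt S q (Suc (d k) + Suc (\<Sum>k\<in>K. d k) - 1) (\<lambda>x. g k x * (\<Prod>k\<in>K. g k x))"
    by (intro deg_lt_mult) auto
  then show ?case using insert by simp
qed

lemma deg_lt_coordinate: "deg_lt S q 2 (\<lambda>x. int (x i))"
proof -
  have "pdiff j (\<lambda>x. int (x i)) = (\<lambda>x. of_bool (i = j))" for j :: 'a
    by (rule ext) (auto simp: pdiff_def)
  then have "\<forall>j\<in>S. deg_lt S q (Suc 0) (pdiff j (\<lambda>x. int (x i)))"
    using deg_lt_const by (auto simp del: deg_lt.simps simp: of_bool_def)
  then show ?thesis by (simp add: numeral_2_eq_2)
qed

lemma deg_lt_cmult_cancel:
  "deg_lt S 0 n (\<lambda>x. c * g x) \<Longrightarrow> c \<noteq> 0 \<Longrightarrow> deg_lt S 0 n g"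
proof (induction n arbitrary: g)
  case (Suc n)
  have "pdiff i (\<lambda>x. c * g x) = (\<lambda>x. c * pdiff i g x)" for i
    by (rule ext) (simp add: pdiff_def algebra_simps)
  then show ?case using Suc by simp
qed simp

section \<open>Binomial coefficients of functions of bounded degree\<close>

lemma fact_times_binomial: "fact k * int (n choose k) = (\<Prod>i<k. int n - int i)"
proof (induction k)
  case (Suc k)
  have "Suc k * (n choose Suc k) = (n - k) * (n choose k)"
    using binomial_absorption[of k n] binomial_absorb_comp[of n k] by simp
  then have "int (Suc k) * int (n choose Suc k) = (int n - int k) * int (n choose k)"
  proof (cases "k \<le> n")
    case True
    then show ?thesis
      using \<open>Suc k * (n choose Suc k) = (n - k) * (n choose k)\<close> by (metis of_nat_diff of_nat_mult)
  qed (simp add: binomial_eq_0)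
  moreover have "(\<Prod>i<Suc k. int n - int i) = (int n - int k) * (fact k * int (n choose k))"
    using Suc by simp
  moreover have "fact (Suc k) * int (n choose Suc k) = fact k * (int (Suc k) * int (n choose Suc k))"
    by simp
  ultimately show ?case by (simp only: ac_simps)
qed simp

text \<open>The factorial denominator is harmless because a difference of an integer multiple vanishes
  only if the difference itself does.\<close>

lemma deg_lt_binomial:
  assumes "deg_lt S 0 (Suc d) (\<lambda>x. int (F x))"
  shows "deg_lt S 0 (Suc (k * d)) (\<lambda>x. int (F x choose k))"
proof -
  have "deg_lt S 0 (Suc (\<Sum>i\<in>{..<k}. d)) (\<lambda>x. \<Prod>i\<in>{..<k}. int (F x) - int i)"
  proof (rule deg_lt_prod)
    fix i
    show "deg_lt S 0 (Suc d) (\<lambda>x. int (F x) - int i)"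
      using deg_lt_add[OF assms deg_lt_const[of S 0 d "- int i"]] by simp
  qed simp
  then have "deg_lt S 0 (Suc (k * d)) (\<lambda>x. fact k * int (F x choose k))"
    by (simp add: fact_times_binomial)
  then show ?thesis by (rule deg_lt_cmult_cancel) simp
qed

section \<open>Frozen coordinates, Newton expansion in one coordinate, lifting to the
  integers\<close>

lemma pdiff_fun_upd_other:
  "i \<noteq> j \<Longrightarrow> pdiff j (\<lambda>x. g (x(i := y))) = (\<lambda>x. pdiff j g (x(i := y)))"
  by (rule ext) (simp add: pdiff_def fun_upd_twist)

text \<open>Once coordinate \<open>i\<close> is frozen, the difference in direction \<open>i\<close>
  is 0 and the other differences commute with the substitution. This turns a parameter into a
  coordinate.\<close>

lemma deg_lt_fun_upd:
  "deg_lt S q n g \<Longrightarrow> i \<notin> S \<Longrightarrow> deg_lt (insert i S) q n (\<lambda>x. g (x(i := y)))"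
proof (induction n arbitrary: g)
  case (Suc n)
  have "deg_lt (insert i S) q n (pdiff j (\<lambda>x. g (x(i := y))))" if "j \<in> insert i S" for j
  proof (cases "j = i")
    case True
    then have "pdiff j (\<lambda>x. g (x(i := y))) = (\<lambda>x. 0)" by (intro ext) (simp add: pdiff_def)
    then show ?thesis by (auto intro: deg_lt_0_imp)
  next
    case False
    then show ?thesis using Suc that by (simp add: pdiff_fun_upd_other del: fun_upd_apply fun_upd_def)
  qed
  then show ?case by (simp only: deg_lt.simps) blast
qed simp

lemma deg_lt_subset: "deg_lt T q n g \<Longrightarrow> S \<subseteq> T \<Longrightarrow> deg_lt S q n g"
  by (induction n arbitrary: g) auto

lemma deg_lt_subset_fun_upd:
  assumes "deg_lt (insert i S) q n g" "i \<notin> S"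
  shows "deg_lt S q n (\<lambda>x. g (x(i := y)))"
  using deg_lt_subset[OF deg_lt_fun_upd[OF deg_lt_subset[OF assms(1)] assms(2)]] by auto

text \<open>The truncated \<open>n - m\<close> is intended: for \<open>m \<ge> n\<close> it is 0, so
  all values are divisible by \<open>q\<close>. This is what cuts off Newton expansions.\<close>

lemma deg_lt_pdiff_power:
  assumes "deg_lt S q n g" "i \<in> S"
  shows "deg_lt S q (n - m) ((pdiff i ^^ m) g)"
proof -
  have "deg_lt S q (n + m) g \<Longrightarrow> deg_lt S q n ((pdiff i ^^ m) g)" for n g
    by (induction m arbitrary: g) (use assms(2) in \<open>auto simp: funpow_Suc_right simp del: funpow.simps\<close>)
  moreover have "deg_lt S q (n - m + m) g" by (rule deg_lt_mono[OF assms(1)]) simp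
  ultimately show ?thesis by blast
qed

lemma fdiff_power_fun_upd:
  "(fdiff ^^ m) (\<lambda>y. g (x(i := y))) y = (pdiff i ^^ m) g (x(i := y))"
  by (induction m arbitrary: y) (simp_all add: fdiff_def pdiff_def)

lemma newton_expansion_coordinate:
  "g (x(i := y)) = (\<Sum>m\<le>y. int (y choose m) * (pdiff i ^^ m) g (x(i := 0)))"
  using newton_expansion[of "\<lambda>y. g (x(i := y))" 0 y] by (simp add: fdiff_power_fun_upd)

lemma deg_lt_newton_expansion:
  assumes "deg_lt S q n g" "i \<in> S"
  shows "q dvd g (x(i := y)) - (\<Sum>m<n. int (y choose m) * (pdiff i ^^ m) g (x(i := 0)))"
proof -
  let ?t = "\<lambda>m. int (y choose m) * (pdiff i ^^ m) g (x(i := 0))"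
  have "g (x(i := y)) = (\<Sum>m\<in>{..y}. ?t m)" by (rule newton_expansion_coordinate)
  \<comment> \<open>Padding to a range that contains both \<open>{..y}\<close> and
    \<open>{..<n}\<close>; the new terms vanish because \<open>y choose m = 0\<close> for
    \<open>m > y\<close>.\<close>
  also have "\<dots> = (\<Sum>m\<in>{..<max (Suc y) n}. ?t m)"
    by (rule sum.mono_neutral_left) auto
  also have "{..<max (Suc y) n} = {..<n} \<union> {n..<max (Suc y) n}" by auto
  also have "(\<Sum>m\<in>\<dots>. ?t m) = (\<Sum>m<n. ?t m) + (\<Sum>m\<in>{n..<max (Suc y) n}. ?t m)"
    by (rule sum.union_disjoint) auto
  finally have "g (x(i := y)) - (\<Sum>m<n. ?t m) = (\<Sum>m\<in>{n..<max (Suc y) n}. ?t m)"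
    by (simp only: add_diff_cancel_left')
  also have "q dvd \<dots>"
  proof (intro dvd_sum dvd_mult)
    fix m assume "m \<in> {n..<max (Suc y) n}"
    then show "q dvd (pdiff i ^^ m) g (x(i := 0))"
      using deg_lt_pdiff_power[OF assms, of m] by simp
  qed
  finally show ?thesis .
qed

text \<open>The Newton coefficients in one coordinate are functions of lower degree in the remaining
  ones. They are lifted by induction and recombined with binomial coefficients, which have the right
  degree over \<int>. The lift has natural values so that \<open>F x choose k\<close> makes
  sense.\<close>

lemma deg_lt_lift:
  assumes "finite S" "deg_lt S q n g" "q > 0"
  shows "\<exists>F. deg_lt S 0 n (\<lambda>x. int (F x)) \<and> (\<forall>x. q dvd g x - int (F x))"
  using assms(1,2)
proof (induction S arbitrary: n g rule: finite_induct)
  case empty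
  show ?case
  \<comment> \<open>Without coordinates the condition at \<open>Suc m\<close> is vacuous, and the
    residue of \<open>g x\<close> modulo \<open>q\<close> serves; at 0 all values are multiples of
    \<open>q\<close>.\<close>
  proof (cases n)
    case 0
    then show ?thesis using empty by (intro exI[of _ "\<lambda>_. 0"]) simp
  next
    case (Suc m)
    then show ?thesis using assms(3)
      by (intro exI[of _ "\<lambda>x. nat (g x mod q)"]) (simp add: mod_eq_dvd_iff[symmetric])
  qed
next
  case (insert i S)
  define h where "h m = (\<lambda>x. (pdiff i ^^ m) g (x(i := 0)))" for m
  have "deg_lt S q (n - m) (h m)" for m
    unfolding h_def using deg_lt_pdiff_power[OF insert.prems, of i m] insert.hyps(2)
    by (intro deg_lt_subset_fun_upd) auto
  then have "\<forall>m. \<exists>F. deg_lt S 0 (n - m) (\<lambda>x. int (F x)) \<and> (\<forall>x. q dvd h m x - int (F x))"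
    using insert.IH by blast
  then obtain F where F: "\<And>m. deg_lt S 0 (n - m) (\<lambda>x. int (F m x))"
    and Fh: "\<And>m x. q dvd h m x - int (F m x)" by metis
  let ?G = "\<lambda>x. \<Sum>m<n. (x i choose m) * F m (x(i := 0))"
  have "deg_lt (insert i S) 0 n (\<lambda>x. \<Sum>m\<in>{..<n}. int (x i choose m) * int (F m (x(i := 0))))"
  proof (rule deg_lt_sum)
    fix m assume m: "m \<in> {..<n}"
    have "deg_lt (insert i S) 0 (Suc (m * 1)) (\<lambda>x. int (x i choose m))"
      by (rule deg_lt_binomial) (use deg_lt_coordinate in \<open>simp add: numeral_2_eq_2 del: deg_lt.simps\<close>)
    moreover have "deg_lt (insert i S) 0 (n - m) (\<lambda>x. int (F m (x(i := 0))))"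
      using deg_lt_fun_upd[OF F insert.hyps(2)] by simp
    ultimately have "deg_lt (insert i S) 0 (Suc (m * 1) + (n - m) - 1)
        (\<lambda>x. int (x i choose m) * int (F m (x(i := 0))))" by (rule deg_lt_mult)
    then show "deg_lt (insert i S) 0 n (\<lambda>x. int (x i choose m) * int (F m (x(i := 0))))"
      using m by simp
  qed
  then have "deg_lt (insert i S) 0 n (\<lambda>x. int (?G x))" by simp
  moreover have "q dvd g x - int (?G x)" for x
  proof -
    have "q dvd g x - (\<Sum>m<n. int (x i choose m) * h m x)"
      using deg_lt_newton_expansion[OF insert.prems, of i x "x i"] by (simp add: h_def)
    \<comment> \<open>The coefficients ignore coordinate \<open>i\<close>, so they may be compared
      with the lifts evaluated at \<open>x(i := 0)\<close>, as they occur in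
      \<open>?G\<close>.\<close>
    moreover have "h m x = h m (x(i := 0))" for m by (simp add: h_def)
    then have "q dvd (\<Sum>m<n. int (x i choose m) * (h m x - int (F m (x(i := 0)))))"
      using Fh by (intro dvd_sum dvd_mult) metis
    ultimately have "q dvd (g x - (\<Sum>m<n. int (x i choose m) * h m x)) +
       (\<Sum>m<n. int (x i choose m) * (h m x - int (F m (x(i := 0)))))" by (rule dvd_add)
    then show ?thesis by (simp add: right_diff_distrib sum_subtractf)
  qed
  ultimately show ?case by (intro exI[of _ ?G] conjI allI)
qed

subsection \<open>Sums over boxes\<close>

lemma sum_PiE_insert:
  assumes "i \<notin> S"
  shows "(\<Sum>x\<in>Pi\<^sub>E (insert i S) T. g x) = (\<Sum>y\<in>T i. \<Sum>x\<in>Pi\<^sub>E S T. g (x(i := y)))"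
proof -
  have "(\<Sum>x\<in>Pi\<^sub>E (insert i S) T. g x) = (\<Sum>z\<in>T i \<times> Pi\<^sub>E S T. g ((\<lambda>(y, x). x(i := y)) z))"
    unfolding PiE_insert_eq by (rule sum.reindex[unfolded o_def]) (rule inj_combinator[OF assms])
  then show ?thesis by (simp add: sum.cartesian_product case_prod_unfold)
qed

lemma sum_lessThan_choose: "(\<Sum>y<n. y choose m) = n choose Suc m"
  by (induction n) simp_all

text \<open>In \<open>m * (p ^ a choose m) = p ^ a * (p ^ a - 1 choose (m - 1))\<close> the exact
  power of \<open>p\<close> in \<open>m\<close> cancels, and what remains of \<open>m\<close> is
  coprime to \<open>p\<close>.\<close>

lemma prime_power_dvd_choose:
  assumes "prime p" "0 < m" "m \<le> p ^ a"
  shows "multiplicity p m \<le> a" and "p ^ (a - multiplicity p m) dvd p ^ a choose m"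
proof -
  let ?v = "multiplicity p m"
  have v: "p ^ ?v \<le> p ^ a"
    using multiplicity_dvd[of p m] dvd_imp_le assms(2,3) by (meson order_trans)
  then show va: "?v \<le> a" using assms(1) prime_gt_1_nat power_le_imp_le_exp by blast
  obtain u where u: "m = p ^ ?v * u" "\<not> p dvd u"
    using multiplicity_decompose'[of m p] assms(1,2) not_prime_unit by (metis bot_nat_0.not_eq_extremum)
  have 1: "m * (p ^ a choose m) = p ^ a * (p ^ a - 1 choose (m - 1))"
    using binomial_absorption[of "m - 1" "p ^ a"] assms(2) by simp
  have "p ^ a = p ^ ?v * p ^ (a - ?v)" using va by (simp flip: power_add)
  then have "p ^ ?v * (u * (p ^ a choose m)) = p ^ ?v * (p ^ (a - ?v) * (p ^ a - 1 choose (m - 1)))"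
    by (metis 1 u(1) mult.assoc)
  then have "u * (p ^ a choose m) = p ^ (a - ?v) * (p ^ a - 1 choose (m - 1))"
    using prime_gt_0_nat[OF assms(1)] by simp
  then have "p ^ (a - ?v) dvd u * (p ^ a choose m)" by simp
  moreover have "coprime (p ^ (a - ?v)) u"
    using u(2) assms(1) by (simp add: prime_imp_coprime coprime_power_left_iff)
  ultimately show "p ^ (a - ?v) dvd p ^ a choose m"
    by (simp add: coprime_dvd_mult_right_iff)
qed

text \<open>Induction over the coordinates. Expanding in coordinate \<open>i\<close> and summing
  over it leaves terms with the factor \<open>p ^ \<alpha> i choose Suc m\<close> and a sum of
  degree below \<open>n - m\<close> over the smaller box. The exponent \<open>e i\<close> in the
  last hypothesis stands for the multiplicity of \<open>p\<close> in \<open>Suc m\<close>.\<close>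

lemma prime_power_dvd_box_sum:
  assumes "prime p" "finite S" "deg_lt S 0 n g"
    and "\<And>e. (\<And>i. i \<in> S \<Longrightarrow> e i \<le> \<alpha> i) \<Longrightarrow> (\<Sum>i\<in>S. p ^ e i - 1) < n \<Longrightarrow>
      w + (\<Sum>i\<in>S. e i) \<le> (\<Sum>i\<in>S. \<alpha> i)"
  shows "int p ^ w dvd (\<Sum>x\<in>Pi\<^sub>E S (\<lambda>i. {..<p ^ \<alpha> i}). g x)"
  using assms(2-)
proof (induction S arbitrary: n g w rule: finite_induct)
  case empty
  show ?case
  proof (cases n)
    case 0
    then show ?thesis using empty by simp
  next
    case (Suc m)
    then show ?thesis using empty(2)[of "\<lambda>_. 0"] by simp
  qed
next
  case (insert i S)
  let ?box = "Pi\<^sub>E S (\<lambda>i. {..<p ^ \<alpha> i})"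
  define h where "h m = (\<lambda>x. (pdiff i ^^ m) g (x(i := 0)))" for m
  have h: "deg_lt S 0 (n - m) (h m)" for m
    unfolding h_def using deg_lt_pdiff_power[OF insert.prems(1), of i m] insert.hyps(2)
    by (intro deg_lt_subset_fun_upd) auto
  have g: "g (x(i := y)) = (\<Sum>m<n. int (y choose m) * h m x)" for x y
    unfolding h_def using deg_lt_newton_expansion[OF insert.prems(1) insertI1, of x y]
    by (simp only: dvd_0_left_iff right_minus_eq)
  have "(\<Sum>x\<in>Pi\<^sub>E (insert i S) (\<lambda>i. {..<p ^ \<alpha> i}). g x) =
      (\<Sum>y<p ^ \<alpha> i. \<Sum>x\<in>?box. \<Sum>m<n. int (y choose m) * h m x)"
    by (simp only: sum_PiE_insert[OF insert.hyps(2)] g)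
  also have "\<dots> = (\<Sum>y<p ^ \<alpha> i. \<Sum>m<n. \<Sum>x\<in>?box. int (y choose m) * h m x)"
    by (intro sum.cong refl sum.swap)
  also have "\<dots> = (\<Sum>m<n. \<Sum>y<p ^ \<alpha> i. int (y choose m) * (\<Sum>x\<in>?box. h m x))"
    by (subst sum.swap) (simp add: sum_distrib_left)
  also have "\<dots> = (\<Sum>m<n. int (p ^ \<alpha> i choose Suc m) * (\<Sum>x\<in>?box. h m x))"
    by (simp only: sum_distrib_right[symmetric] of_nat_sum[symmetric] sum_lessThan_choose)
  also have "int p ^ w dvd \<dots>"
  proof (rule dvd_sum)
    fix m assume m: "m \<in> {..<n}"
    let ?a = "\<alpha> i" and ?v = "multiplicity p (Suc m)"
    show "int p ^ w dvd int (p ^ \<alpha> i choose Suc m) * (\<Sum>x\<in>?box. h m x)"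
    proof (cases "Suc m \<le> p ^ ?a")
      case True
      note v = prime_power_dvd_choose[OF assms(1) _ True, simplified]
      have pv: "p ^ ?v \<le> Suc m" by (intro dvd_imp_le multiplicity_dvd) simp
      have "int p ^ (w - (?a - ?v)) dvd (\<Sum>x\<in>?box. h m x)"
      proof (rule insert.IH[OF h])
        fix e assume e: "\<And>j. j \<in> S \<Longrightarrow> e j \<le> \<alpha> j" and lt: "(\<Sum>j\<in>S. p ^ e j - 1) < n - m"
        \<comment> \<open>Extending \<open>e\<close> by \<open>?v\<close> at \<open>i\<close> is
          admissible: \<open>p ^ ?v\<close> divides \<open>Suc m\<close>, so
          \<open>p ^ ?v - 1 \<le> m\<close> fits into the degree used up by coordinate
          \<open>i\<close>.\<close>
        have "w + (\<Sum>j\<in>insert i S. (e(i := ?v)) j) \<le> (\<Sum>j\<in>insert i S. \<alpha> j)"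
        proof (rule insert.prems(2))
          fix j assume "j \<in> insert i S"
          then show "(e(i := ?v)) j \<le> \<alpha> j" using e v(1) by auto
        next
          have "(\<Sum>j\<in>S. p ^ (e(i := ?v)) j - 1) = (\<Sum>j\<in>S. p ^ e j - 1)"
            using insert.hyps(2) by (intro sum.cong) auto
          then show "(\<Sum>j\<in>insert i S. p ^ (e(i := ?v)) j - 1) < n"
            using insert.hyps lt pv by simp
        qed
        moreover have "(\<Sum>j\<in>S. (e(i := ?v)) j) = (\<Sum>j\<in>S. e j)"
          using insert.hyps(2) by (intro sum.cong) auto
        ultimately have "w + ?v + (\<Sum>j\<in>S. e j) \<le> ?a + (\<Sum>j\<in>S. \<alpha> j)"
          using insert.hyps by simp
        \<comment> \<open>Settles the case \<open>w < ?a - ?v\<close>, in which the truncated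
          difference is 0.\<close>
        moreover have "(\<Sum>j\<in>S. e j) \<le> (\<Sum>j\<in>S. \<alpha> j)" using e by (rule sum_mono)
        ultimately show "w - (?a - ?v) + (\<Sum>j\<in>S. e j) \<le> (\<Sum>j\<in>S. \<alpha> j)" using v(1) by linarith
      qed
      moreover have "int p ^ (?a - ?v) dvd int (p ^ ?a choose Suc m)"
        using v(2) by (metis of_nat_dvd_iff of_nat_power)
      ultimately have "int p ^ (?a - ?v) * int p ^ (w - (?a - ?v)) dvd
         int (p ^ ?a choose Suc m) * (\<Sum>x\<in>?box. h m x)"
        by (rule mult_dvd_mono[rotated])
      then have "int p ^ ((?a - ?v) + (w - (?a - ?v))) dvd
         int (p ^ ?a choose Suc m) * (\<Sum>x\<in>?box. h m x)" by (simp only: power_add)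
      then show ?thesis by (rule power_le_dvd) simp
    qed (simp add: binomial_eq_0)
  qed
  finally show ?case .
qed

lemma deg_lt_cong:
  assumes "deg_lt S q n g" "\<And>x. q dvd h x - g x"
  shows "deg_lt S q n h"
proof -
  have "deg_lt S q n (\<lambda>x. h x - g x)" using assms(2) by (simp add: deg_lt_0_imp)
  from deg_lt_add[OF assms(1) this] show ?thesis by simp
qed

subsection \<open>Pulling back to the natural numbers\<close>

text \<open>The projection of \<nat>-valued vectors onto the product of the \<int>/m i. The
  restriction to \<open>I\<close> makes the result extensional, as elements of
  \<open>sum_group\<close> are.\<close>

definition residue_vec :: "'i set \<Rightarrow> ('i \<Rightarrow> nat) \<Rightarrow> ('i \<Rightarrow> nat) \<Rightarrow> 'i \<Rightarrow> int" where
  "residue_vec I m x = (\<lambda>i\<in>I. int (x i) mod int (m i))"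

lemma carrier_sum_group_integer_mod_group:
  assumes "finite I" "\<And>i. i \<in> I \<Longrightarrow> m i > 0"
  shows "carrier (sum_group I (\<lambda>i. integer_mod_group (m i))) = Pi\<^sub>E I (\<lambda>i. {0..<int (m i)})"
proof -
  have "carrier (sum_group I (\<lambda>i. integer_mod_group (m i))) =
      Pi\<^sub>E I (\<lambda>i. carrier (integer_mod_group (m i)))"
    using assms(1) by (simp add: carrier_sum_group)
  also have "\<dots> = Pi\<^sub>E I (\<lambda>i. {0..<int (m i)})"
    using assms(2) by (intro PiE_cong) (auto simp: carrier_integer_mod_group)
  finally show ?thesis .
qed

lemma residue_vec_in_carrier:
  assumes "finite I" "\<And>i. i \<in> I \<Longrightarrow> m i > 0"
  shows "residue_vec I m x \<in> carrier (sum_group I (\<lambda>i. integer_mod_group (m i)))"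
proof -
  have "residue_vec I m x \<in> Pi\<^sub>E I (\<lambda>i. {0..<int (m i)})"
    using assms(2) by (auto simp: residue_vec_def)
  then show ?thesis
    using carrier_sum_group_integer_mod_group[of I m, OF assms] by simp
qed

lemma bij_betw_residue_vec:
  assumes "finite I" "\<And>i. i \<in> I \<Longrightarrow> m i > 0"
  shows "bij_betw (residue_vec I m) (Pi\<^sub>E I (\<lambda>i. {..<m i}))
    (carrier (sum_group I (\<lambda>i. integer_mod_group (m i))))"
proof (rule bij_betw_byWitness[where f' = "\<lambda>x. \<lambda>i\<in>I. nat (x i)"])
  show "\<forall>a\<in>Pi\<^sub>E I (\<lambda>i. {..<m i}). (\<lambda>i\<in>I. nat (residue_vec I m a i)) = a"
    by (auto simp: residue_vec_def PiE_iff extensional_def fun_eq_iff nat_mod_distrib)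
  show "\<forall>a'\<in>carrier (sum_group I (\<lambda>i. integer_mod_group (m i))).
      residue_vec I m (\<lambda>i\<in>I. nat (a' i)) = a'"
  proof
    fix y assume "y \<in> carrier (sum_group I (\<lambda>i. integer_mod_group (m i)))"
    then have "y \<in> Pi\<^sub>E I (\<lambda>i. {0..<int (m i)})"
      using carrier_sum_group_integer_mod_group[of I m, OF assms] by simp
    then show "residue_vec I m (\<lambda>i\<in>I. nat (y i)) = y"
      by (auto simp: residue_vec_def PiE_iff extensional_def fun_eq_iff)
  qed
  show "residue_vec I m ` Pi\<^sub>E I (\<lambda>i. {..<m i}) \<subseteq> carrier (sum_group I (\<lambda>i. integer_mod_group (m i)))"
    by (intro image_subsetI residue_vec_in_carrier assms)
  show "(\<lambda>x. \<lambda>i\<in>I. nat (x i)) ` carrier (sum_group I (\<lambda>i. integer_mod_group (m i))) \<subseteq> Pi\<^sub>E I (\<lambda>i. {..<m i})"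
  proof (rule image_subsetI)
    fix y assume "y \<in> carrier (sum_group I (\<lambda>i. integer_mod_group (m i)))"
    then have "y \<in> Pi\<^sub>E I (\<lambda>i. {0..<int (m i)})"
      using carrier_sum_group_integer_mod_group[of I m, OF assms] by simp
    then show "(\<lambda>i\<in>I. nat (y i)) \<in> Pi\<^sub>E I (\<lambda>i. {..<m i})"
      by (auto simp: PiE_iff nat_less_iff)
  qed
qed

text \<open>A unit step in coordinate \<open>i\<close> becomes a group translation, which is how
  \<open>pdiff i\<close> corresponds to \<open>fwd_diff\<close>.\<close>

lemma residue_vec_Suc:
  "residue_vec I m (x(i := Suc (x i))) =
    residue_vec I m x \<otimes>\<^bsub>sum_group I (\<lambda>i. integer_mod_group (m i))\<^esub> residue_vec I m (\<lambda>j. of_bool (j = i))"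
  by (auto simp: residue_vec_def fun_eq_iff mod_add_eq add.commute[of 1])

text \<open>It suffices to take differences along the images of the unit vectors. Modulo
  \<open>q\<close>, \<open>pdiff i\<close> of the pullback is the pullback of such a
  difference.\<close>

lemma deg_lt_if_diffs_vanish:
  fixes I :: "'i set" and m :: "'i \<Rightarrow> nat" and q :: nat
  defines "A \<equiv> sum_group I (\<lambda>i. integer_mod_group (m i))" and "B \<equiv> integer_mod_group q"
  assumes I: "finite I" "\<And>i. i \<in> I \<Longrightarrow> m i > 0" and "q > 0"
    and "h \<in> carrier A \<rightarrow> carrier B" "diffs_vanish A B h n"
  shows "deg_lt I (int q) n (\<lambda>x. h (residue_vec I m x))"
  using assms(6,7)
proof (induction n arbitrary: h)
  have R: "residue_vec I m x \<in> carrier A" for x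
    unfolding A_def using I by (rule residue_vec_in_carrier)
  {
    case 0
    then show ?case using R by (simp add: diffs_vanish_def zero_fun_def B_def)
  next
    case (Suc n)
    interpret A: group A by (simp add: A_def)
    interpret B: group B by (simp add: B_def)
    have "deg_lt I (int q) n (pdiff i (\<lambda>x. h (residue_vec I m x)))" for i
    proof -
      define a where "a = residue_vec I m (\<lambda>j. of_bool (j = i))"
      have a: "a \<in> carrier A" by (simp add: a_def R)
      have "deg_lt I (int q) n (\<lambda>x. fwd_diff A B a h (residue_vec I m x))"
      proof (rule Suc.IH)
        show "fwd_diff A B a h \<in> carrier A \<rightarrow> carrier B"
          using Suc.prems(1) a by (auto simp: fwd_diff_def intro!: B.m_closed B.inv_closed)
        have "zero_fun A B (foldr (fwd_diff A B) as (fwd_diff A B a h))"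
          if "length as = n" "set as \<subseteq> carrier A" for as
          \<comment> \<open>\<open>foldr\<close> applies the last list entry first, so the
            difference already taken goes to the end of the list.\<close>
          using Suc.prems(2) that a unfolding diffs_vanish_def
          by (auto dest!: spec[of _ "as @ [a]"])
        then show "diffs_vanish A B (fwd_diff A B a h) n" by (simp add: diffs_vanish_def)
      qed
      then show ?thesis
      proof (rule deg_lt_cong)
        fix x
        let ?x = "residue_vec I m x"
        have x: "h ?x \<in> carrier B" using Suc.prems(1) R by blast
        \<comment> \<open>The inverse in \<int>/q and the group operation both reduce modulo
          \<open>q\<close>, so the two differences agree only up to multiples of
          \<open>q\<close>.\<close>
        have "fwd_diff A B a h ?x = (h (residue_vec I m (x(i := Suc (x i)))) + (- h ?x) mod int q) mod int q"
          using x by (simp add: fwd_diff_def residue_vec_Suc A_def a_def B_def)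
        also have "\<dots> = pdiff i (\<lambda>x. h (residue_vec I m x)) x mod int q"
          by (simp add: pdiff_def mod_simps)
        finally show "int q dvd pdiff i (\<lambda>x. h (residue_vec I m x)) x - fwd_diff A B a h ?x"
          by (simp add: minus_mod_eq_mult_div)
      qed
    qed
    then show ?case by simp
  }
qed

subsection \<open>Divisibility of the number of zeros\<close>

text \<open>In the hypothesis on \<open>w\<close>, \<open>s\<close> is the power of \<open>p\<close>
  supplied by the Newton coefficients. Each such factor raises the degree bound by at most
  \<open>(p - 1) * c\<close>, and the sum over the box has to supply the rest of
  \<open>w\<close>.\<close>

lemma prime_power_dvd_card_zeros:
  fixes g :: "'j \<Rightarrow> ('i \<Rightarrow> nat) \<Rightarrow> int" and w :: nat
  assumes p: "prime p" and fin: "finite I" "finite J"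
    and \<beta>: "\<And>j. j \<in> J \<Longrightarrow> \<beta> j \<ge> 1"
    and g: "\<And>j. j \<in> J \<Longrightarrow> deg_lt I (int p ^ \<beta> j) (Suc (d j)) (g j)"
    and c: "\<And>j. j \<in> J \<Longrightarrow> d j * p ^ (\<beta> j - 1) \<le> c"
    and w: "\<And>e s. (\<And>i. i \<in> I \<Longrightarrow> e i \<le> \<alpha> i) \<Longrightarrow>
      (\<Sum>i\<in>I. p ^ e i - 1) \<le> (\<Sum>j\<in>J. d j * (p ^ \<beta> j - 1)) + s * ((p - 1) * c) \<Longrightarrow>
      w + (\<Sum>i\<in>I. e i) \<le> (\<Sum>i\<in>I. \<alpha> i) + s"
  shows "int p ^ w dvd int (card {x \<in> Pi\<^sub>E I (\<lambda>i. {..<p ^ \<alpha> i}). \<forall>j\<in>J. int p ^ \<beta> j dvd g j x})"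
proof -
  let ?box = "Pi\<^sub>E I (\<lambda>i. {..<p ^ \<alpha> i})"
  have p0: "p > 0" using p prime_gt_0_nat by blast
  have finbox: "finite ?box" using fin by (intro finite_PiE) auto
  have "\<forall>j\<in>J. \<exists>F. deg_lt I 0 (Suc (d j)) (\<lambda>x. int (F x)) \<and> (\<forall>x. int p ^ \<beta> j dvd g j x - int (F x))"
  proof
    fix j assume "j \<in> J"
    from deg_lt_lift[OF fin(1) g[OF this]] p0
    show "\<exists>F. deg_lt I 0 (Suc (d j)) (\<lambda>x. int (F x)) \<and> (\<forall>x. int p ^ \<beta> j dvd g j x - int (F x))"
      by simp
  qed
  then obtain F where F: "\<And>j. j \<in> J \<Longrightarrow> deg_lt I 0 (Suc (d j)) (\<lambda>x. int (F j x))"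
    and Fg: "\<And>j x. j \<in> J \<Longrightarrow> int p ^ \<beta> j dvd g j x - int (F j x)" by metis
  \<comment> \<open>\<open>\<delta> j\<close> has period \<open>p ^ \<beta> j\<close>, and
    \<open>a j k\<close> is its \<open>k\<close>-th Newton coefficient at 0.\<close>
  define \<delta> where "\<delta> j n = (of_bool (p ^ \<beta> j dvd n) :: int)" for j n
  define a where "a j k = (fdiff ^^ k) (\<delta> j) 0" for j k
  have "\<forall>j\<in>J. \<forall>k. \<exists>s. int p ^ s dvd a j k \<and> k \<le> p ^ \<beta> j - 1 + s * (p ^ \<beta> j - p ^ (\<beta> j - 1))"
  proof (intro ballI allI)
    fix j k assume j: "j \<in> J"
    have "\<delta> j (n + p ^ \<beta> j) = \<delta> j n" for n by (simp add: \<delta>_def)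
    then show "\<exists>s. int p ^ s dvd a j k \<and> k \<le> p ^ \<beta> j - 1 + s * (p ^ \<beta> j - p ^ (\<beta> j - 1))"
      unfolding a_def by (rule fdiff_power_periodic_dvd[OF p \<beta>[OF j]])
  qed
  then obtain s where s: "\<And>j k. j \<in> J \<Longrightarrow> int p ^ s j k dvd a j k"
    and k_le: "\<And>j k. j \<in> J \<Longrightarrow> k \<le> p ^ \<beta> j - 1 + s j k * (p ^ \<beta> j - p ^ (\<beta> j - 1))" by metis
  \<comment> \<open>A common cut-off: \<open>K\<close> bounds all values of the \<open>F j\<close>
    on the box, so all expansions can run over \<open>k \<le> K\<close>.\<close>
  define K where "K = (\<Sum>j\<in>J. \<Sum>x\<in>?box. F j x)"
  have F_le: "F j x \<le> K" if "j \<in> J" "x \<in> ?box" for j x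
  proof -
    have "F j x \<le> (\<Sum>x\<in>?box. F j x)" using that finbox by (intro member_le_sum) auto
    also have "\<dots> \<le> K" unfolding K_def using that fin(2) by (intro member_le_sum) auto
    finally show ?thesis .
  qed
  have \<delta>: "\<delta> j (F j x) = (\<Sum>k\<le>K. a j k * int (F j x choose k))" if "j \<in> J" "x \<in> ?box" for j x
  proof -
    have "\<delta> j (F j x) = (\<Sum>k\<le>F j x. a j k * int (F j x choose k))"
      using newton_expansion[of "\<delta> j" 0 "F j x"] by (simp add: a_def mult.commute)
    also have "\<dots> = (\<Sum>k\<le>K. a j k * int (F j x choose k))"
      using F_le[OF that] by (intro sum.mono_neutral_left) auto
    finally show ?thesis .
  qed
  let ?E = "Pi\<^sub>E J (\<lambda>_. {..K})"
  have "int (card {x \<in> ?box. \<forall>j\<in>J. int p ^ \<beta> j dvd g j x}) = (\<Sum>x\<in>?box. \<Prod>j\<in>J. \<delta> j (F j x))"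
  proof -
    have "int p ^ \<beta> j dvd g j x \<longleftrightarrow> p ^ \<beta> j dvd F j x" if "j \<in> J" for j x
    proof -
      have "int p ^ \<beta> j dvd g j x \<longleftrightarrow> int p ^ \<beta> j dvd int (F j x)"
        using dvd_add_right_iff[OF Fg[OF that, of x], of "int (F j x)"] by simp
      also have "\<dots> \<longleftrightarrow> p ^ \<beta> j dvd F j x" by (metis of_nat_dvd_iff of_nat_power)
      finally show ?thesis .
    qed
    then have eq: "{x \<in> ?box. \<forall>j\<in>J. int p ^ \<beta> j dvd g j x} = ?box \<inter> {x. \<forall>j\<in>J. p ^ \<beta> j dvd F j x}"
      by auto
    have "(\<Prod>j\<in>J. \<delta> j (F j x)) = of_bool (\<forall>j\<in>J. p ^ \<beta> j dvd F j x)" for x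
      unfolding \<delta>_def using fin(2) by (induction J rule: finite_induct) auto
    then show ?thesis unfolding eq using finbox by simp
  qed
  also have "\<dots> = (\<Sum>x\<in>?box. \<Prod>j\<in>J. \<Sum>k\<le>K. a j k * int (F j x choose k))"
    by (intro sum.cong prod.cong refl \<delta>)
  also have "\<dots> = (\<Sum>x\<in>?box. \<Sum>\<kappa>\<in>?E. \<Prod>j\<in>J. a j (\<kappa> j) * int (F j x choose \<kappa> j))"
    by (intro sum.cong refl prod_sum_PiE) (use fin in auto)
  also have "\<dots> = (\<Sum>\<kappa>\<in>?E. \<Sum>x\<in>?box. \<Prod>j\<in>J. a j (\<kappa> j) * int (F j x choose \<kappa> j))"
    by (rule sum.swap)
  also have "\<dots> = (\<Sum>\<kappa>\<in>?E. (\<Prod>j\<in>J. a j (\<kappa> j)) * (\<Sum>x\<in>?box. \<Prod>j\<in>J. int (F j x choose \<kappa> j)))"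
    by (simp add: prod.distrib sum_distrib_left)
  also have "int p ^ w dvd \<dots>"
  proof (rule dvd_sum)
    fix \<kappa> assume "\<kappa> \<in> ?E"
    define \<sigma> where "\<sigma> = (\<Sum>j\<in>J. s j (\<kappa> j))"
    have "int p ^ \<sigma> = (\<Prod>j\<in>J. int p ^ s j (\<kappa> j))" unfolding \<sigma>_def by (rule power_sum)
    also have "\<dots> dvd (\<Prod>j\<in>J. a j (\<kappa> j))" using s by (rule prod_dvd_prod)
    finally have 1: "int p ^ \<sigma> dvd (\<Prod>j\<in>J. a j (\<kappa> j))" .
    have deg: "deg_lt I 0 (Suc (\<Sum>j\<in>J. \<kappa> j * d j)) (\<lambda>x. \<Prod>j\<in>J. int (F j x choose \<kappa> j))"
      using fin(2) deg_lt_binomial[OF F] by (rule deg_lt_prod)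
    \<comment> \<open>The period bound on \<open>\<kappa> j\<close>, multiplied by
      \<open>d j\<close>: one more factor \<open>p\<close> costs
      \<open>(p - 1) * (d j * p ^ (\<beta> j - 1))\<close> in degree, at most
      \<open>(p - 1) * c\<close>.\<close>
    have kd: "\<kappa> j * d j \<le> d j * (p ^ \<beta> j - 1) + s j (\<kappa> j) * ((p - 1) * c)" if j: "j \<in> J" for j
    proof -
      have "p ^ \<beta> j - p ^ (\<beta> j - 1) = (p - 1) * p ^ (\<beta> j - 1)"
        using \<beta>[OF j] by (cases "\<beta> j") (simp_all add: algebra_simps)
      then have "\<kappa> j * d j \<le> (p ^ \<beta> j - 1 + s j (\<kappa> j) * ((p - 1) * p ^ (\<beta> j - 1))) * d j"
        using k_le[OF j, of "\<kappa> j"] by simp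
      also have "\<dots> = d j * (p ^ \<beta> j - 1) + s j (\<kappa> j) * ((p - 1) * (d j * p ^ (\<beta> j - 1)))"
        by (simp add: add_mult_distrib2 mult_ac)
      also have "\<dots> \<le> d j * (p ^ \<beta> j - 1) + s j (\<kappa> j) * ((p - 1) * c)"
        using c[OF j] by (intro add_left_mono mult_left_mono) auto
      finally show ?thesis .
    qed
    have D: "(\<Sum>j\<in>J. \<kappa> j * d j) \<le> (\<Sum>j\<in>J. d j * (p ^ \<beta> j - 1)) + \<sigma> * ((p - 1) * c)"
      unfolding \<sigma>_def sum_distrib_right sum.distrib[symmetric] by (rule sum_mono) (rule kd)
    have 2: "int p ^ (w - \<sigma>) dvd (\<Sum>x\<in>?box. \<Prod>j\<in>J. int (F j x choose \<kappa> j))"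
    proof (rule prime_power_dvd_box_sum[OF p fin(1) deg])
      fix e assume e: "\<And>i. i \<in> I \<Longrightarrow> e i \<le> \<alpha> i" "(\<Sum>i\<in>I. p ^ e i - 1) < Suc (\<Sum>j\<in>J. \<kappa> j * d j)"
      have "w + (\<Sum>i\<in>I. e i) \<le> (\<Sum>i\<in>I. \<alpha> i) + \<sigma>"
        using e D by (intro w) auto
      \<comment> \<open>Settles the case \<open>\<sigma> > w\<close>, in which
        \<open>w - \<sigma>\<close> is 0.\<close>
      moreover have "(\<Sum>i\<in>I. e i) \<le> (\<Sum>i\<in>I. \<alpha> i)" using e(1) by (rule sum_mono)
      ultimately show "w - \<sigma> + (\<Sum>i\<in>I. e i) \<le> (\<Sum>i\<in>I. \<alpha> i)" by linarith
    qed
    have "int p ^ (\<sigma> + (w - \<sigma>)) dvd (\<Prod>j\<in>J. a j (\<kappa> j)) * (\<Sum>x\<in>?box. \<Prod>j\<in>J. int (F j x choose \<kappa> j))"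
      unfolding power_add using 1 2 by (rule mult_dvd_mono)
    then show "int p ^ w dvd (\<Prod>j\<in>J. a j (\<kappa> j)) * (\<Sum>x\<in>?box. \<Prod>j\<in>J. int (F j x choose \<kappa> j))"
      by (rule power_le_dvd) simp
  qed
  finally show ?thesis .
qed

subsection \<open>The optimisation problem\<close>

text \<open>Exchange argument: the head \<open>x\<close> is at most some \<open>y\<close> in
  \<open>M\<close> whose removal leaves a submultiset of the tail, namely \<open>x\<close> itself if
  it lies in \<open>M\<close> and any element otherwise.\<close>

lemma sum_list_take_le_sum_mset:
  fixes xs :: "nat list"
  assumes "sorted xs" "M \<subseteq># mset xs"
  shows "sum_list (take (size M) xs) \<le> sum_mset M"
  using assms
proof (induction xs arbitrary: M)
  case (Cons x xs)
  show ?case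
  proof (cases "M = {#}")
    case False
    obtain y where y: "y \<in># M" "x \<le> y" "M - {#y#} \<subseteq># mset xs"
    proof (cases "x \<in># M")
      case True
      then have "M - {#x#} \<subseteq># mset xs"
        using Cons.prems(2) by (simp add: subset_eq_diff_conv)
      then show ?thesis using that True by blast
    next
      case False
      then have sub: "M \<subseteq># mset xs"
        using Cons.prems(2) by (metis diff_single_trivial mset.simps(2) subset_eq_diff_conv add_mset_add_single)
      obtain y where y: "y \<in># M" using \<open>M \<noteq> {#}\<close> by blast
      then have "y \<in> set xs" using sub by (metis mset_subset_eqD set_mset_mset)
      then have "x \<le> y" using Cons.prems(1) by simp
      moreover have "M - {#y#} \<subseteq># mset xs"
        using sub by (meson diff_subset_eq_self subset_mset.order_trans)
      ultimately show ?thesis using that y by blast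
    qed
    then obtain M' where M': "M = add_mset y M'" by (metis insert_DiffM)
    have "sum_list (take (size M') xs) \<le> sum_mset M'"
      using Cons.IH[of M'] Cons.prems(1) y M' by simp
    then show ?thesis using y M' by simp
  qed simp
qed simp

lemma sum_subseteq_mset:
  "(\<And>i. i \<in> I \<Longrightarrow> f i \<subseteq># g i) \<Longrightarrow> (\<Sum>i\<in>I. f i) \<subseteq># (\<Sum>i\<in>I. g i)"
  by (induction I rule: infinite_finite_induct) (auto intro: subset_mset.add_mono)

text \<open>Both sides contain one power \<open>p ^ l\<close> for each pair of \<open>i\<close> and
  \<open>l < \<alpha> i\<close>; \<open>conj_part N \<alpha> (Suc l)\<close> counts the
  \<open>i\<close> for a fixed \<open>l\<close>. The hypothesis ensures that the range of
  \<open>D_list\<close>, which ends at \<open>\<alpha> 1\<close>, covers every such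
  \<open>l\<close>.\<close>

lemma mset_D_list:
  assumes "\<And>i. i \<in> {1..N} \<Longrightarrow> \<alpha> i \<le> \<alpha> 1"
  shows "mset (D_list p N \<alpha>) = (\<Sum>i=1..N. image_mset (\<lambda>l. p ^ l) (mset_set {..<\<alpha> i}))"
proof -
  have rep: "replicate_mset (card I) x = (\<Sum>i\<in>I. {#x#})" if "finite I" for I :: "nat set" and x :: nat
    using that by (induction I rule: finite_induct) simp_all
  have img: "image_mset g (mset_set {..<n}) = (\<Sum>l<n. {#g l#})" for g :: "nat \<Rightarrow> nat" and n
    by (induction n) (simp_all add: lessThan_Suc)
  have "mset (D_list p N \<alpha>) = (\<Sum>j\<leftarrow>[1..<\<alpha> 1 + 1]. replicate_mset (conj_part N \<alpha> j) (p ^ (j - 1)))"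
    by (simp add: D_list_def mset_concat o_def)
  also have "\<dots> = (\<Sum>j\<in>{1..<\<alpha> 1 + 1}. replicate_mset (conj_part N \<alpha> j) (p ^ (j - 1)))"
    by (simp add: sum_list_distinct_conv_sum_set del: upt_Suc)
  also have "\<dots> = (\<Sum>l\<in>{..<\<alpha> 1}. replicate_mset (conj_part N \<alpha> (Suc l)) (p ^ l))"
    by (rule sum.reindex_bij_witness[of _ Suc "\<lambda>j. j - 1"]) auto
  also have "\<dots> = (\<Sum>l\<in>{..<\<alpha> 1}. \<Sum>i\<in>{i \<in> {1..N}. l < \<alpha> i}. {#p ^ l#})"
    by (simp add: conj_part_def rep Suc_le_eq)
  also have "\<dots> = (\<Sum>i\<in>{1..N}. \<Sum>l\<in>{l \<in> {..<\<alpha> 1}. l < \<alpha> i}. {#p ^ l#})"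
    by (rule sum.swap_restrict) auto
  also have "\<dots> = (\<Sum>i\<in>{1..N}. \<Sum>l\<in>{..<\<alpha> i}. {#p ^ l#})"
    using assms by (intro sum.cong) (auto intro: less_le_trans)
  finally show ?thesis by (simp only: img)
qed

lemma sorted_D_list:
  assumes "p \<ge> 1"
  shows "sorted (D_list p N \<alpha>)"
proof -
  have "sorted (concat (map (\<lambda>j. replicate (conj_part N \<alpha> j) (p ^ (j - 1))) [1..<n + 1]))" for n
    by (induction n) (auto simp: sorted_append intro!: power_increasing assms)
  then show ?thesis by (simp only: D_list_def)
qed

lemma length_D_list:
  assumes "\<And>i. i \<in> {1..N} \<Longrightarrow> \<alpha> i \<le> \<alpha> 1"
  shows "length (D_list p N \<alpha>) = (\<Sum>i=1..N. \<alpha> i)"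
proof -
  have "size (mset (D_list p N \<alpha>)) =
      size (\<Sum>i=1..N. image_mset (\<lambda>l. p ^ l) (mset_set {..<\<alpha> i}))"
    by (subst mset_D_list) (use assms in auto)
  then show ?thesis by (simp add: size_multiset_sum)
qed

text \<open>The powers \<open>p ^ l\<close> with \<open>l < e i\<close> form a submultiset of
  \<open>D_list\<close>, so their sum is at least that of equally many smallest entries.\<close>

lemma sum_list_take_D_list_le:
  assumes "p \<ge> 1" "\<And>i. i \<in> {1..N} \<Longrightarrow> \<alpha> i \<le> \<alpha> 1" "\<And>i. i \<in> {1..N} \<Longrightarrow> e i \<le> \<alpha> i"
  shows "sum_list (take (\<Sum>i=1..N. e i) (D_list p N \<alpha>)) \<le> (\<Sum>i=1..N. \<Sum>l<e i. p ^ l)"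
proof -
  let ?m = "\<lambda>a. \<Sum>i=1..N. image_mset (\<lambda>l. p ^ l) (mset_set {..<a i})"
  have "?m e \<subseteq># ?m \<alpha>"
  proof (rule sum_subseteq_mset)
    fix i assume "i \<in> {1..N}"
    then show "image_mset (\<lambda>l. p ^ l) (mset_set {..<e i}) \<subseteq># image_mset (\<lambda>l. p ^ l) (mset_set {..<\<alpha> i})"
      using assms(3) by (intro image_mset_subseteq_mono subset_imp_msubset_mset_set) auto
  qed
  also have "?m \<alpha> = mset (D_list p N \<alpha>)"
    by (rule mset_D_list[symmetric]) (rule assms(2))
  finally have "sum_list (take (size (?m e)) (D_list p N \<alpha>)) \<le> sum_mset (?m e)"
    using sorted_D_list[OF assms(1)] by (intro sum_list_take_le_sum_mset)
  moreover have "size (?m e) = (\<Sum>i=1..N. e i)" by (simp add: size_multiset_sum)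
  moreover have "sum_mset (?m e) = (\<Sum>i=1..N. \<Sum>l<e i. p ^ l)"
  proof -
    have "sum_mset (\<Sum>i\<in>I. h i) = (\<Sum>i\<in>I. sum_mset (h i))" for I :: "nat set" and h :: "nat \<Rightarrow> nat multiset"
      by (induction I rule: infinite_finite_induct) simp_all
    then show ?thesis by (simp add: sum_unfold_sum_mset)
  qed
  ultimately show ?thesis by simp
qed

section \<open>Convexity of geometric sums and the role of L\<close>

text \<open>Convexity: the geometric sum grows by \<open>p ^ l\<close> from \<open>l\<close> to
  \<open>l + 1\<close>, and \<open>c\<close> lies between the increments before and after
  \<open>L\<close>. So the line of slope \<open>c\<close> through the point at
  \<open>min a L\<close> stays below the graph on \<open>e \<le> a\<close>.\<close>

lemma geometric_sum_truncation:
  fixes c :: real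
  assumes "p \<ge> 2" "L \<ge> 1" "real p ^ (L - 1) \<le> c" "c \<le> real p ^ L" "e \<le> a"
  shows "(real p ^ min a L - 1) / (real p - 1) + (real e - real (min a L)) * c \<le> (real p ^ e - 1) / (real p - 1)"
proof -
  let ?b = "min a L"
  have G: "(real p ^ n - 1) / (real p - 1) = (\<Sum>l<n. real p ^ l)" for n
    using assms(1) by (subst geometric_sum) auto
  show ?thesis unfolding G
  proof (cases "e \<le> ?b")
    case True
    have "(\<Sum>l\<in>{e..<?b}. real p ^ l) \<le> (\<Sum>l\<in>{e..<?b}. c)"
    proof (rule sum_mono)
      fix l assume "l \<in> {e..<?b}"
      then have "real p ^ l \<le> real p ^ (L - 1)" using assms(1) by (intro power_increasing) auto
      then show "real p ^ l \<le> c" using assms(3) by simp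
    qed
    moreover have "(\<Sum>l<?b. real p ^ l) = (\<Sum>l<e. real p ^ l) + (\<Sum>l\<in>{e..<?b}. real p ^ l)"
      using True by (simp add: lessThan_atLeast0 sum.atLeastLessThan_concat)
    ultimately show "(\<Sum>l<?b. real p ^ l) + (real e - real ?b) * c \<le> (\<Sum>l<e. real p ^ l)"
      using True by (simp add: of_nat_diff algebra_simps)
  next
    case False
    then have b: "?b = L" "L \<le> e" using assms(5) by auto
    have "(\<Sum>l\<in>{L..<e}. c) \<le> (\<Sum>l\<in>{L..<e}. real p ^ l)"
    proof (rule sum_mono)
      fix l assume "l \<in> {L..<e}"
      then have "real p ^ L \<le> real p ^ l" using assms(1) by (intro power_increasing) auto
      then show "c \<le> real p ^ l" using assms(4) by simp
    qed
    moreover have "(\<Sum>l<e. real p ^ l) = (\<Sum>l<L. real p ^ l) + (\<Sum>l\<in>{L..<e}. real p ^ l)"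
      using b by (simp add: lessThan_atLeast0 sum.atLeastLessThan_concat)
    ultimately show "(\<Sum>l<?b. real p ^ l) + (real e - real ?b) * c \<le> (\<Sum>l<e. real p ^ l)"
      unfolding b(1) using b(2) by (simp add: of_nat_diff algebra_simps)
  qed
qed

text \<open>An exponent above \<open>L\<close> can be lowered by one at a gain of at least \<open>p\<^sup>L \<ge> c\<close>.\<close>

lemma lower_exponents:
  fixes c b :: real
  assumes "p \<ge> 2" "finite I" "c \<le> real p ^ L"
    and "(\<Sum>i\<in>I. \<Sum>l<min (\<alpha> i) L. real p ^ l) \<le> b"
    and "\<And>i. i \<in> I \<Longrightarrow> e i \<le> \<alpha> i" "(\<Sum>i\<in>I. \<Sum>l<e i. real p ^ l) \<le> b + real s * c"
  shows "\<exists>e'. (\<forall>i\<in>I. e' i \<le> \<alpha> i) \<and> (\<Sum>i\<in>I. \<Sum>l<e' i. real p ^ l) \<le> b \<and> (\<Sum>i\<in>I. e i) \<le> (\<Sum>i\<in>I. e' i) + s"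
  using assms(5,6)
proof (induction s arbitrary: e)
  case 0
  then show ?case by (intro exI[of _ e]) simp
next
  case (Suc s)
  show ?case
  proof (cases "\<exists>i\<in>I. L < e i")
    case True
    then obtain i where i: "i \<in> I" "L < e i" by blast
    then obtain m where m: "e i = Suc m" by (cases "e i") auto
    let ?e = "e(i := m)"
    have "real p ^ L \<le> real p ^ m" using i m assms(1) by (intro power_increasing) auto
    then have c: "c \<le> real p ^ m" using assms(3) by simp
    have rest: "(\<Sum>j\<in>I - {i}. \<Sum>l<?e j. real p ^ l) = (\<Sum>j\<in>I - {i}. \<Sum>l<e j. real p ^ l)"
      "(\<Sum>j\<in>I - {i}. ?e j) = (\<Sum>j\<in>I - {i}. e j)" by (auto intro: sum.cong)
    have 1: "(\<Sum>j\<in>I. \<Sum>l<e j. real p ^ l) = (\<Sum>j\<in>I. \<Sum>l<?e j. real p ^ l) + real p ^ m"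
      using i(1) assms(2) m rest by (simp add: sum.remove[of I i])
    have 2: "(\<Sum>j\<in>I. e j) = Suc (\<Sum>j\<in>I. ?e j)"
      using i(1) assms(2) m rest by (simp add: sum.remove[of I i])
    have "\<exists>e'. (\<forall>i\<in>I. e' i \<le> \<alpha> i) \<and> (\<Sum>i\<in>I. \<Sum>l<e' i. real p ^ l) \<le> b \<and> (\<Sum>i\<in>I. ?e i) \<le> (\<Sum>i\<in>I. e' i) + s"
    proof (rule Suc.IH)
      show "?e j \<le> \<alpha> j" if "j \<in> I" for j using Suc.prems(1)[OF that] m by auto
      show "(\<Sum>j\<in>I. \<Sum>l<?e j. real p ^ l) \<le> b + real s * c"
        using 1 c Suc.prems(2) by (simp add: algebra_simps)
    qed
    then show ?thesis unfolding 2 by auto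
  next
    case False
    \<comment> \<open>With no exponent above \<open>L\<close> left, \<open>e\<close> lies below
      \<open>min (\<alpha> i) L\<close> everywhere and already meets the bound
      \<open>b\<close>.\<close>
    have "(\<Sum>i\<in>I. \<Sum>l<e i. real p ^ l) \<le> (\<Sum>i\<in>I. \<Sum>l<min (\<alpha> i) L. real p ^ l)"
      using False Suc.prems(1) by (intro sum_mono sum_mono2) (auto simp: not_less intro: less_le_trans)
    then show ?thesis using assms(4) Suc.prems(1) by (intro exI[of _ e]) auto
  qed
qed

text \<open>For \<open>k\<close> the floor of the logarithm,
  \<open>p ^ k \<le> d < p ^ (k + 1)\<close>; multiplying by \<open>p ^ (b - 1)\<close> places
  \<open>d * p ^ (b - 1)\<close> between two consecutive powers of \<open>p\<close>, the upper one
  being \<open>p ^ L\<close>.\<close>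

lemma floor_log_power_bounds:
  assumes "p \<ge> 2" "d \<ge> 1" "b \<ge> 1" and L: "L = nat (int b + \<lfloor>log (real p) (real d)\<rfloor>)"
  shows "L \<ge> 1" "int L = int b + \<lfloor>log (real p) (real d)\<rfloor>"
    "real p ^ (L - 1) \<le> real d * real p ^ (b - 1)" "real d * real p ^ (b - 1) \<le> real p ^ L"
proof -
  define k where "k = nat \<lfloor>log (real p) (real d)\<rfloor>"
  have "log (real p) (real d) \<ge> 0" using assms(1,2) by (subst zero_le_log_cancel_iff) auto
  then have k: "\<lfloor>log (real p) (real d)\<rfloor> = int k" by (simp add: k_def)
  then have "real p powr real k \<le> real d" "real d < real p powr (real k + 1)"
    using assms(1,2) floor_log_eq_powr_iff[of "real d" "real p" "int k"] by auto
  then have kd: "real p ^ k \<le> real d" "real d < real p ^ (k + 1)"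
    using assms(1) by (simp_all add: powr_realpow powr_add mult.commute)
  have Lk: "L = b + k" using L k by simp
  then show "L \<ge> 1" "int L = int b + \<lfloor>log (real p) (real d)\<rfloor>" using assms(3) k by auto
  have "L - 1 = k + (b - 1)" "L = (k + 1) + (b - 1)" using Lk assms(3) by auto
  then have e: "real p ^ (L - 1) = real p ^ k * real p ^ (b - 1)" "real p ^ L = real p ^ (k + 1) * real p ^ (b - 1)"
    by (simp_all only: power_add)
  show "real p ^ (L - 1) \<le> real d * real p ^ (b - 1)" "real d * real p ^ (b - 1) \<le> real p ^ L"
    unfolding e using kd by (auto intro!: mult_right_mono)
qed

section \<open>Degrees, valuations and zero sets as they occur in the theorem\<close>

lemma sum_nth_eq_sum_list_take:
  fixes xs :: "nat list"
  assumes "t \<le> length xs"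
  shows "(\<Sum>s=1..t. xs ! (s - 1)) = sum_list (take t xs)"
proof -
  have "(\<Sum>s=1..t. xs ! (s - 1)) = (\<Sum>i=0..<t. xs ! i)"
    by (rule sum.reindex_bij_witness[of _ Suc "\<lambda>s. s - 1"]) auto
  then show ?thesis using assms by (simp add: sum_list_sum_nth)
qed

text \<open>Positivity excludes the value -\<infinity> and the upper bound excludes \<infinity>, so
  \<open>fdeg\<close> is given by its \<open>LEAST\<close> branch.\<close>

lemma diffs_vanish_if_fdeg_le:
  assumes "0 < fdeg A B f" "fdeg A B f \<le> ereal (real d)"
  shows "\<exists>k\<le>d. diffs_vanish A B f (Suc k)"
proof -
  have nz: "\<not> zero_fun A B f" using assms(1) by (auto simp: fdeg_def)
  then have ex: "\<exists>k. diffs_vanish A B f (k + 1)"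
    using assms(2) by (auto simp: fdeg_def split: if_splits)
  then have "fdeg A B f = ereal (real (LEAST k. diffs_vanish A B f (k + 1)))"
    using nz by (simp add: fdeg_def)
  then have "(LEAST k. diffs_vanish A B f (k + 1)) \<le> d" using assms(2) by simp
  moreover have "diffs_vanish A B f ((LEAST k. diffs_vanish A B f (k + 1)) + 1)"
    using ex by (rule LeastI_ex)
  ultimately show ?thesis by auto
qed

lemma le_padic_ord:
  assumes "prime p" "int p ^ w dvd n"
  shows "ereal (real w) \<le> padic_ord p n"
proof (cases "n = 0")
  case False
  have "\<not> is_unit (int p)" using prime_gt_1_nat[OF assms(1)] by simp
  then have "w \<le> multiplicity (int p) n" using assms(2) False by (intro multiplicity_geI)
  then show ?thesis using False by (simp add: padic_ord_def)
qed (simp add: padic_ord_def)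

text \<open>The projection is a bijection from the box onto \<open>A\<close>, and 0 is the only
  multiple of \<open>p ^ \<beta> j\<close> among the representatives that make up the carrier of
  \<open>B j\<close>.\<close>

lemma card_common_zeros:
  fixes \<alpha> \<beta> :: "nat \<Rightarrow> nat" and p N r :: nat and f :: "nat \<Rightarrow> (nat \<Rightarrow> int) \<Rightarrow> int"
  defines "A \<equiv> sum_group {1..N} (\<lambda>i. integer_mod_group (p ^ \<alpha> i))"
    and "B \<equiv> (\<lambda>j. integer_mod_group (p ^ \<beta> j))"
  assumes p: "p > 0" and f: "\<And>j. j \<in> {1..r} \<Longrightarrow> f j \<in> carrier A \<rightarrow> carrier (B j)"
  shows "card (common_zeros A B r f) =
    card {x \<in> Pi\<^sub>E {1..N} (\<lambda>i. {..<p ^ \<alpha> i}).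
      \<forall>j\<in>{1..r}. int p ^ \<beta> j dvd f j (residue_vec {1..N} (\<lambda>i. p ^ \<alpha> i) x)}"
proof -
  let ?\<pi> = "residue_vec {1..N} (\<lambda>i. p ^ \<alpha> i)" and ?box = "Pi\<^sub>E {1..N} (\<lambda>i. {..<p ^ \<alpha> i})"
  let ?Z = "{x \<in> ?box. \<forall>j\<in>{1..r}. int p ^ \<beta> j dvd f j (?\<pi> x)}"
  have bij: "bij_betw ?\<pi> ?box (carrier A)"
    unfolding A_def by (rule bij_betw_residue_vec) (use p in auto)
  have zero: "int p ^ \<beta> j dvd f j y \<longleftrightarrow> f j y = \<one>\<^bsub>B j\<^esub>" if "j \<in> {1..r}" "y \<in> carrier A" for j y
  proof -
    have "f j y \<in> carrier (B j)" using f[OF that(1)] that(2) by blast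
    then have "0 \<le> f j y" "f j y < int p ^ \<beta> j"
      using p by (auto simp: B_def carrier_integer_mod_group)
    then show ?thesis by (auto simp: B_def dest: zdvd_imp_le)
  qed
  have image: "?\<pi> ` ?Z = common_zeros A B r f"
  proof (intro equalityI subsetI)
    fix y assume "y \<in> ?\<pi> ` ?Z"
    then obtain x where x: "x \<in> ?Z" "y = ?\<pi> x" by blast
    then have "y \<in> carrier A" using bij by (auto simp: bij_betw_def)
    then show "y \<in> common_zeros A B r f" using x zero by (simp add: common_zeros_def)
  next
    fix y assume y: "y \<in> common_zeros A B r f"
    then have "y \<in> carrier A" by (simp add: common_zeros_def)
    then obtain x where x: "x \<in> ?box" "y = ?\<pi> x" using bij by (auto simp: bij_betw_def)
    then have "x \<in> ?Z" using y zero \<open>y \<in> carrier A\<close> by (simp add: common_zeros_def B_def)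
    then show "y \<in> ?\<pi> ` ?Z" using x by blast
  qed
  have "inj_on ?\<pi> ?Z"
    using bij unfolding bij_betw_def by (rule inj_on_subset[OF conjunct1]) blast
  then show ?thesis unfolding image[symmetric] by (rule card_image)
qed

lemma le_first_if_decreasing:
  fixes h :: "nat \<Rightarrow> nat"
  assumes "\<And>i. i \<in> {1..<n} \<Longrightarrow> h (i + 1) \<le> h i" "i \<in> {1..n}"
  shows "h i \<le> h 1"
proof -
  have "1 \<le> i" "i \<le> n" using assms(2) by auto
  then show ?thesis
  proof (induction i rule: dec_induct)
    case (step i)
    then show ?case using assms(1)[of i] by simp
  qed simp
qed

theorem theorem1p6:
  fixes p r N :: nat
    and \<alpha> \<beta> d :: "nat \<Rightarrow> nat"
    and f :: "nat \<Rightarrow> (nat \<Rightarrow> int) \<Rightarrow> int"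
  defines "A \<equiv> sum_group {1..N} (\<lambda>i. integer_mod_group (p ^ \<alpha> i))"
    and "B \<equiv> (\<lambda>j. integer_mod_group (p ^ \<beta> j))"
    and "\<B> \<equiv> (\<Sum>j=1..r. real (d j) * ((real p ^ \<beta> j - 1) / (real p - 1)))"
    and "L \<equiv> int (\<beta> 1) + \<lfloor>log (real p) (real (d 1))\<rfloor>"
  defines "\<alpha>b \<equiv> (\<lambda>i. nat (min (int (\<alpha> i)) L))"
    and "\<alpha>sum \<equiv> (\<Sum>i=1..N. \<alpha> i)"
  defines "\<alpha>bsum \<equiv> (\<Sum>i=1..N. \<alpha>b i)"
    and "\<A>b \<equiv> (\<Sum>i=1..N. (real p ^ \<alpha>b i - 1) / (real p - 1))"
    and "D \<equiv> (\<lambda>s. D_list p N \<alpha> ! (s - 1))"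
  assumes "prime p"
    and "r \<ge> 1" and "N \<ge> 1"
    and "\<And>j. j \<in> {1..r} \<Longrightarrow> \<beta> j \<ge> 1"
    and "\<And>j. j \<in> {1..r} \<Longrightarrow> d j \<ge> 1"
    and "\<And>i. i \<in> {1..N} \<Longrightarrow> \<alpha> i \<ge> 1"
    and "\<And>j. j \<in> {1..r} \<Longrightarrow> f j \<in> carrier A \<rightarrow> carrier (B j)"
    and "\<And>j. j \<in> {1..r} \<Longrightarrow> 0 < fdeg A (B j) (f j)"
    and "\<And>j. j \<in> {1..r} \<Longrightarrow> fdeg A (B j) (f j) \<le> ereal (real (d j))"
    and "\<And>i. i \<in> {1..<N} \<Longrightarrow> \<alpha> i \<ge> \<alpha> (i + 1)"
    and "\<And>j. j \<in> {1..<r} \<Longrightarrow> d j * p ^ \<beta> j \<ge> d (j + 1) * p ^ \<beta> (j + 1)"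
  shows "padic_ord p (int (card (common_zeros A B r f))) \<ge>
    ereal (real_of_int
      (if \<A>b > \<B>
       then \<lceil>(\<A>b - \<B>) / (real (d 1) * real p ^ (\<beta> 1 - 1))\<rceil> + int \<alpha>sum - int \<alpha>bsum
       else int \<alpha>sum - int (Max {t \<in> {1..\<alpha>sum}. real (\<Sum>s=1..t. D s) \<le> \<B>})))"
proof -
  note \<beta> = assms(13) and d = assms(14) and f = assms(16)
  define c where "c = d 1 * p ^ (\<beta> 1 - 1)"
  define Ln where "Ln = nat L"
  define E where "E = (\<lambda>e. \<Sum>i=1..N. \<Sum>l<e i. real p ^ l)"
  have p2: "p \<ge> 2" using \<open>prime p\<close> by (rule prime_ge_2_nat)
  have r1: "1 \<in> {1..r}" using \<open>r \<ge> 1\<close> by simp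
  note L = floor_log_power_bounds[OF p2 d[OF r1] \<beta>[OF r1] Ln_def[unfolded L_def]]
  have rc: "real c = real (d 1) * real p ^ (\<beta> 1 - 1)" by (simp add: c_def)
  have c0: "real c > 0" unfolding rc using d[OF r1] p2 by simp
  \<comment> \<open>\<open>L\<close> is nonnegative, so \<open>nat\<close> loses nothing and
    \<open>\<alpha>b i\<close> is a minimum of natural numbers.\<close>
  have "L = int Ln" using L(2) by (simp add: L_def)
  then have \<alpha>b: "\<alpha>b i = min (\<alpha> i) Ln" for i by (simp add: \<alpha>b_def)
  have G: "(\<Sum>l<n. real p ^ l) = (real p ^ n - 1) / (real p - 1)" for n
    using p2 by (subst geometric_sum) auto
  have G': "real (p ^ n - 1) = (real p - 1) * (\<Sum>l<n. real p ^ l)" for n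
    using p2 unfolding G by (simp add: of_nat_diff)
  have \<alpha>1: "\<alpha> i \<le> \<alpha> 1" if "i \<in> {1..N}" for i
    using assms(19) that by (rule le_first_if_decreasing)
  \<comment> \<open>The ordering of the \<open>d j * p ^ \<beta> j\<close>, divided by
    \<open>p\<close>, makes \<open>c\<close> the largest of the
    \<open>d j * p ^ (\<beta> j - 1)\<close>.\<close>
  have dc: "d j * p ^ (\<beta> j - 1) \<le> c" if "j \<in> {1..r}" for j
  proof -
    have "d j * p ^ \<beta> j \<le> d 1 * p ^ \<beta> 1"
      by (rule le_first_if_decreasing[of r "\<lambda>j. d j * p ^ \<beta> j", OF assms(20) that])
    moreover have "p ^ \<beta> k = p * p ^ (\<beta> k - 1)" if "k \<in> {1..r}" for k
      using \<beta>[OF that] by (cases "\<beta> k") auto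
    ultimately have "p * (d j * p ^ (\<beta> j - 1)) \<le> p * c"
      using that r1 by (simp add: c_def mult_ac)
    then show ?thesis using p2 by simp
  qed
  have deg: "deg_lt {1..N} (int p ^ \<beta> j) (Suc (d j)) (\<lambda>x. f j (residue_vec {1..N} (\<lambda>i. p ^ \<alpha> i) x))"
    if j: "j \<in> {1..r}" for j
  proof -
    obtain k where k: "k \<le> d j" "diffs_vanish A (B j) (f j) (Suc k)"
      using diffs_vanish_if_fdeg_le[OF assms(17,18)[OF j]] by blast
    have "deg_lt {1..N} (int (p ^ \<beta> j)) (Suc k) (\<lambda>x. f j (residue_vec {1..N} (\<lambda>i. p ^ \<alpha> i) x))"
      by (rule deg_lt_if_diffs_vanish)
         (use p2 f[OF j] k(2) in \<open>simp_all add: A_def B_def\<close>)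
    then have "deg_lt {1..N} (int (p ^ \<beta> j)) (Suc (d j)) (\<lambda>x. f j (residue_vec {1..N} (\<lambda>i. p ^ \<alpha> i) x))"
      by (rule deg_lt_mono) (use k(1) in simp)
    then show ?thesis by (simp del: deg_lt.simps)
  qed
  \<comment> \<open>The condition of \<open>prime_power_dvd_card_zeros\<close>, divided by
    \<open>p - 1\<close>. Both cases now only have to compare \<open>E e\<close> with
    \<open>\<B> + real s * real c\<close>.\<close>
  have key: "ereal (real w) \<le> padic_ord p (int (card (common_zeros A B r f)))"
    if w: "\<And>e s. (\<And>i. i \<in> {1..N} \<Longrightarrow> e i \<le> \<alpha> i) \<Longrightarrow> E e \<le> \<B> + real s * real c \<Longrightarrow>
      w + (\<Sum>i=1..N. e i) \<le> \<alpha>sum + s" for w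
  proof (rule le_padic_ord[OF \<open>prime p\<close>])
    have "card (common_zeros A B r f) = card {x \<in> Pi\<^sub>E {1..N} (\<lambda>i. {..<p ^ \<alpha> i}).
        \<forall>j\<in>{1..r}. int p ^ \<beta> j dvd f j (residue_vec {1..N} (\<lambda>i. p ^ \<alpha> i) x)}"
      unfolding A_def B_def by (rule card_common_zeros) (use p2 f in \<open>simp_all add: A_def B_def\<close>)
    moreover have "int p ^ w dvd int (card {x \<in> Pi\<^sub>E {1..N} (\<lambda>i. {..<p ^ \<alpha> i}).
        \<forall>j\<in>{1..r}. int p ^ \<beta> j dvd f j (residue_vec {1..N} (\<lambda>i. p ^ \<alpha> i) x)})"
    proof (rule prime_power_dvd_card_zeros[where d = d and c = c])
      fix e s
      assume e: "\<And>i. i \<in> {1..N} \<Longrightarrow> e i \<le> \<alpha> i"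
        and le: "(\<Sum>i\<in>{1..N}. p ^ e i - 1) \<le> (\<Sum>j\<in>{1..r}. d j * (p ^ \<beta> j - 1)) + s * ((p - 1) * c)"
      have "real (\<Sum>i\<in>{1..N}. p ^ e i - 1) = (real p - 1) * E e"
        by (simp only: of_nat_sum G' E_def sum_distrib_left)
      moreover have "real (\<Sum>j\<in>{1..r}. d j * (p ^ \<beta> j - 1)) = (real p - 1) * \<B>"
        by (simp only: of_nat_sum of_nat_mult G' \<B>_def sum_distrib_left G[symmetric] mult.left_commute)
      moreover have "real (s * ((p - 1) * c)) = (real p - 1) * (real s * real c)"
        using p2 by (simp add: of_nat_diff)
      ultimately have "(real p - 1) * E e \<le> (real p - 1) * (\<B> + real s * real c)"
        using le by (simp only: distrib_left flip: of_nat_add)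
      then have "E e \<le> \<B> + real s * real c" using p2 by simp
      then show "w + (\<Sum>i\<in>{1..N}. e i) \<le> (\<Sum>i\<in>{1..N}. \<alpha> i) + s"
        using w[OF e] by (simp add: \<alpha>sum_def)
    qed (use \<open>prime p\<close> \<beta> deg dc in \<open>auto simp del: deg_lt.simps\<close>)
    ultimately show "int p ^ w dvd int (card (common_zeros A B r f))" by simp
  qed
  show ?thesis
  proof (cases "\<A>b > \<B>")
    case True
    define z where "z = \<lceil>(\<A>b - \<B>) / real c\<rceil> + int \<alpha>sum - int \<alpha>bsum"
    have "\<alpha>bsum \<le> \<alpha>sum" unfolding \<alpha>bsum_def \<alpha>sum_def by (rule sum_mono) (simp add: \<alpha>b)
    moreover have "(\<A>b - \<B>) / real c > 0" using True c0 by simp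
    then have "\<lceil>(\<A>b - \<B>) / real c\<rceil> > 0" by simp
    ultimately have z: "z \<ge> 0" unfolding z_def by linarith
    have "ereal (real (nat z)) \<le> padic_ord p (int (card (common_zeros A B r f)))"
    proof (rule key)
      fix e s
      assume e: "\<And>i. i \<in> {1..N} \<Longrightarrow> e i \<le> \<alpha> i" and le: "E e \<le> \<B> + real s * real c"
      \<comment> \<open>The supporting lines of slope \<open>c\<close> at the
        \<open>\<alpha>b i\<close>, summed over \<open>i\<close>. Combined with the upper bound on
        \<open>E e\<close> they bound \<open>(\<A>b - \<B>) / real c\<close> by an integer, so the
        ceiling satisfies the same bound.\<close>
      have "(\<Sum>i=1..N. (real p ^ \<alpha>b i - 1) / (real p - 1) + (real (e i) - real (\<alpha>b i)) * real c) \<le> E e"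
        unfolding E_def G \<alpha>b rc
        by (rule sum_mono, rule geometric_sum_truncation) (use p2 L e in auto)
      also have "(\<Sum>i=1..N. (real p ^ \<alpha>b i - 1) / (real p - 1) + (real (e i) - real (\<alpha>b i)) * real c) =
          \<A>b + (real (\<Sum>i=1..N. e i) - real \<alpha>bsum) * real c"
        by (simp add: sum.distrib \<A>b_def \<alpha>bsum_def sum_subtractf flip: sum_distrib_right)
      finally have "\<A>b - \<B> \<le> (real s + real \<alpha>bsum - real (\<Sum>i=1..N. e i)) * real c"
        using le by (simp add: algebra_simps)
      then have "(\<A>b - \<B>) / real c \<le> real_of_int (int s + int \<alpha>bsum - int (\<Sum>i=1..N. e i))"
        using c0 by (simp add: divide_le_eq)
      then have "\<lceil>(\<A>b - \<B>) / real c\<rceil> \<le> int s + int \<alpha>bsum - int (\<Sum>i=1..N. e i)"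
        by (simp only: ceiling_le_iff)
      then show "nat z + (\<Sum>i=1..N. e i) \<le> \<alpha>sum + s"
        using z unfolding z_def by linarith
    qed
    moreover have "real (nat z) = real_of_int z" using z by simp
    ultimately show ?thesis using True unfolding z_def rc by simp
  next
    case False
    let ?T = "{t \<in> {1..\<alpha>sum}. real (\<Sum>s=1..t. D s) \<le> \<B>}"
    define M where "M = Max ?T"
    have len: "length (D_list p N \<alpha>) = \<alpha>sum" unfolding \<alpha>sum_def using \<alpha>1 by (rule length_D_list)
    \<comment> \<open>The \<open>t\<close> smallest entries of \<open>D_list\<close> sum to at most
      \<open>E e\<close>, which is at most \<open>\<B>\<close>.\<close>
    have in_T: "t \<in> ?T"
      if e: "\<And>i. i \<in> {1..N} \<Longrightarrow> e i \<le> \<alpha> i" "E e \<le> \<B>" "t = (\<Sum>i=1..N. e i)" "t \<ge> 1" for e t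
    proof -
      have t: "t \<le> \<alpha>sum" unfolding e(3) \<alpha>sum_def using e(1) by (rule sum_mono)
      then have "(\<Sum>s=1..t. D s) = sum_list (take t (D_list p N \<alpha>))"
        unfolding D_def by (intro sum_nth_eq_sum_list_take) (simp add: len)
      also have "\<dots> \<le> (\<Sum>i=1..N. \<Sum>l<e i. p ^ l)"
        unfolding e(3) by (rule sum_list_take_D_list_le) (use p2 \<alpha>1 e(1) in auto)
      finally have "real (\<Sum>s=1..t. D s) \<le> real (\<Sum>i=1..N. \<Sum>l<e i. p ^ l)"
        by (simp only: of_nat_le_iff)
      also have "\<dots> = E e" by (simp add: E_def)
      finally show ?thesis using e(2,4) t by simp
    qed
    have \<A>: "(\<Sum>i\<in>{1..N}. \<Sum>l<min (\<alpha> i) Ln. real p ^ l) \<le> \<B>"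
      using False by (simp add: \<A>b_def \<alpha>b G)
    have N1: "1 \<in> {1..N}" using \<open>N \<ge> 1\<close> by simp
    \<comment> \<open>In this case \<open>\<alpha>b\<close> itself is admissible with a positive
      total, so \<open>?T\<close> is nonempty and \<open>Max\<close> is attained.\<close>
    have "E \<alpha>b \<le> \<B>" using \<A> by (simp add: E_def \<alpha>b)
    moreover have "(\<Sum>i=1..N. \<alpha>b i) \<ge> 1"
    proof -
      have "\<alpha>b 1 \<ge> 1" using assms(15)[OF N1] L(1) by (simp add: \<alpha>b)
      also have "\<alpha>b 1 \<le> (\<Sum>i=1..N. \<alpha>b i)" using N1 by (intro member_le_sum) auto
      finally show ?thesis .
    qed
    ultimately have "?T \<noteq> {}" using in_T[of \<alpha>b] by (auto simp: \<alpha>b)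
    then have "M \<in> ?T" unfolding M_def by (intro Max_in) auto
    then have M: "M \<le> \<alpha>sum" by simp
    have "ereal (real (\<alpha>sum - M)) \<le> padic_ord p (int (card (common_zeros A B r f)))"
    proof (rule key)
      fix e s
      assume e: "\<And>i. i \<in> {1..N} \<Longrightarrow> e i \<le> \<alpha> i" and le: "E e \<le> \<B> + real s * real c"
      \<comment> \<open>The surplus \<open>real s * real c\<close> is removed by lowering the total
        of the exponents by at most \<open>s\<close>; the new total is then compared with
        \<open>M\<close>.\<close>
      have "\<exists>e'. (\<forall>i\<in>{1..N}. e' i \<le> \<alpha> i) \<and> (\<Sum>i\<in>{1..N}. \<Sum>l<e' i. real p ^ l) \<le> \<B> \<and>
          (\<Sum>i\<in>{1..N}. e i) \<le> (\<Sum>i\<in>{1..N}. e' i) + s"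
        by (rule lower_exponents[OF p2 _ _ \<A> e le[unfolded E_def]]) (use L(4) rc in auto)
      then obtain e' where e': "\<And>i. i \<in> {1..N} \<Longrightarrow> e' i \<le> \<alpha> i" "E e' \<le> \<B>"
        and es: "(\<Sum>i=1..N. e i) \<le> (\<Sum>i=1..N. e' i) + s"
        unfolding E_def by blast
      have "(\<Sum>i=1..N. e' i) \<le> M"
      \<comment> \<open>\<open>?T\<close> starts at 1, so a total of 0 is treated
        separately.\<close>
      proof (cases "(\<Sum>i=1..N. e' i) \<ge> 1")
        case True
        then have "(\<Sum>i=1..N. e' i) \<in> ?T" using in_T[OF e' refl] by simp
        then show ?thesis unfolding M_def by (intro Max_ge) auto
      qed simp
      then show "\<alpha>sum - M + (\<Sum>i=1..N. e i) \<le> \<alpha>sum + s" using es M by linarith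
    qed
    moreover have "real (\<alpha>sum - M) = real_of_int (int \<alpha>sum - int M)" using M by simp
    ultimately show ?thesis using False unfolding M_def by simp
  qed
qed

end
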